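(* Let $b\ge 2$ be an integer and let $P=\{p_1,\dots,p_s\}$ be a finite set of primes, each relatively prime to $b$. Let $m\in\mathbb{N}_P$, $a\in\mathbb{Z}$ with $\gcd(a,m)=1$, and let $k\ge 0$ be an integer. Then for all $N\in\mathbb{N}$, \[ \left|\sum_{n=1}^N e\!\left(\frac{a}{m}b^n\right)\right|\le\left(A_km^{\alpha_k}N^{\gamma_k}+B_km^{-\alpha_k}N^{\nu_k}\right)(1+\log m)^{2^{-k}}, \] where $\alpha_k=\frac{1}{2^{k+2}-2}$, and $\gamma_k,\nu_k,A_k,B_k$ are defined by $\gamma_0=0$, $\nu_0=1$, $A_0=1$, $B_0=M$ and, for $k\ge1$, \begin{align*} \gamma_k&=\frac{1+\gamma_{k-1}+\alpha_{k-1}\nu_{k-1}}{2(1+\alpha_{k-1})},\qquad \nu_k=\frac{1+\nu_{k-1}}{2}+\frac{(1+\gamma_{k-1}-\nu_{k-1})\alpha_{k-1}}{2(1+\alpha_{k-1})},\\ A_k&=\left(2^{s+2}Q(A_{k-1}+B_{k-1})C_{P,\alpha_{k-1}}+2Q+2A_{k-1}MC_{P,1+\alpha_{k-1}}\right)^{1/2},\\ B_k&=\left(2^{1+\alpha_{k-1}}B_{k-1}MQ^{\alpha_{k-1}}C_{P,1-\alpha_{k-1}}\right)^{1/2}, \end{align*} with $Q=p_1p_2\cdots p_s$.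
   Context: $e(z)=e^{2\pi i z}$. $\mathbb{N}_P$ is the set of positive integers all of whose prime factors lie in $P$ (with $1\in\mathbb{N}_P$). $M=M(P)=p_1^{\beta_1'}\cdots p_s^{\beta_s'}$, where $\beta_i'$ is the exact exponent of $p_i$ dividing $b^{2\operatorname{ord}(b,p_1\cdots p_s)}-1$, with $\operatorname{ord}(b,n)$ the multiplicative order of $b$ modulo $n$. For $x>0$, $C_{P,x}=\prod_{i=1}^s\frac{p_i^{x}}{p_i^{x}-1}$. *)

theory Defs
  imports Complex_Main "HOL-Number_Theory.Number_Theory"
begin

definition e_2pi :: "complex \<Rightarrow> complex" where
  "e_2pi z = exp (2 * of_real pi * \<i> * z)"

definition N_P :: "nat set \<Rightarrow> nat set" where
  "N_P P = {n. n > 0 \<and> (\<forall>p. prime p \<and> p dvd n \<longrightarrow> p \<in> P)}"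

definition Q_P :: "nat set \<Rightarrow> nat" where
  "Q_P P = (\<Prod>p\<in>P. p)"

text \<open>
  The library writes \<open>ord n b\<close>, with the modulus first, for the multiplicative order of \<open>b\<close>
  modulo \<open>n\<close>. It is positive when \<open>b\<close> is coprime to \<open>n\<close>, so for \<open>b \<ge> 2\<close> the
  subtraction below does not truncate and its result is nonzero.
\<close>
definition M_P :: "nat \<Rightarrow> nat set \<Rightarrow> nat" where
  "M_P b P = (\<Prod>p\<in>P. p ^ multiplicity p (b ^ (2 * ord (Q_P P) b) - 1))"

definition C_P :: "nat set \<Rightarrow> real \<Rightarrow> real" where
  "C_P P x = (\<Prod>p\<in>P. real p powr x / (real p powr x - 1))"

definition alpha :: "nat \<Rightarrow> real" where
  "alpha k = 1 / (2 ^ (k + 2) - 2)"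

fun gamma :: "nat \<Rightarrow> real" and nu :: "nat \<Rightarrow> real" where
  "gamma 0 = 0"
| "gamma (Suc k) = (1 + gamma k + alpha k * nu k) / (2 * (1 + alpha k))"
| "nu 0 = 1"
| "nu (Suc k) = (1 + nu k) / 2 + (1 + gamma k - nu k) * alpha k / (2 * (1 + alpha k))"

fun coeff_A :: "nat \<Rightarrow> nat set \<Rightarrow> nat \<Rightarrow> real" and coeff_B :: "nat \<Rightarrow> nat set \<Rightarrow> nat \<Rightarrow> real" where
  "coeff_A b P 0 = 1"
| "coeff_A b P (Suc k) =
    sqrt (2 ^ (card P + 2) * real (Q_P P) * (coeff_A b P k + coeff_B b P k) * C_P P (alpha k)
          + 2 * real (Q_P P) + 2 * coeff_A b P k * real (M_P b P) * C_P P (1 + alpha k))"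
| "coeff_B b P 0 = real (M_P b P)"
| "coeff_B b P (Suc k) =
    sqrt (2 powr (1 + alpha k) * coeff_B b P k * real (M_P b P) * real (Q_P P) powr alpha k
          * C_P P (1 - alpha k))"

end

theory Submission
  imports Defs "HOL-Analysis.Harmonic_Numbers" "HOL-Analysis.Complex_Transcendental"
begin

text \<open>
  For \<open>k = 0\<close>: lifting the exponent shows that the sum over a full period vanishes unless \<open>m\<close>
  divides \<open>M\<close>, in which case the trivial bound suffices; otherwise Parseval bounds the twisted
  period sums by \<open>sqrt m\<close> and completion costs a factor \<open>1 + ln m\<close>.

  From \<open>k\<close> to \<open>k + 1\<close>: apply van der Corput differencing with shifts \<open>h * ord d b\<close> for a divisor
  \<open>d\<close> of \<open>m\<close>. The correlations are sums of the same kind with modulus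
  \<open>m / gcd (b ^ (h * ord d b) - 1) m\<close>, a divisor of \<open>m / d\<close>. Lifting the exponent again makes large
  values of the gcd rare, so the average over the shifts is bounded by an Euler product. The
  choice \<open>d \<approx> (N powr (1 + \<gamma> - \<nu>) * m powr \<alpha>) powr (1 / (1 + \<alpha>))\<close> balances the terms; if it
  exceeds \<open>m\<close>, or \<open>ord d b\<close> exceeds \<open>N\<close>, the trivial bound \<open>N\<close> is already good enough.
\<close>

section \<open>Lifting the exponent\<close>

lemma sum_power_cong:
  fixes x d :: int
  assumes "[x = 1] (mod d)"
  shows "[(\<Sum>i<n. x ^ i) = int n] (mod d)"
proof -
  have "[(\<Sum>i<n. x ^ i) = (\<Sum>i<n. 1 ^ i)] (mod d)"
    by (intro cong_sum cong_pow assms)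
  then show ?thesis by simp
qed

lemma power_cong_linear:
  fixes y :: int
  shows "[(1 + y) ^ n = 1 + int n * y] (mod y\<^sup>2)"
proof (induction n)
  case (Suc n)
  have "[(1 + y) * (1 + y) ^ n = (1 + y) * (1 + int n * y)] (mod y\<^sup>2)"
    by (intro cong_mult Suc cong_refl)
  moreover have "[(1 + y) * (1 + int n * y) = 1 + int (Suc n) * y] (mod y\<^sup>2)"
    by (simp add: cong_iff_dvd_diff algebra_simps power2_eq_square)
  ultimately show ?case
    by (simp add: cong_trans)
qed simp

text \<open>Modulo \<open>p\<^sup>2\<close> the sum is \<open>p\<close>: with
  \<open>x = 1 + y\<close>, the linear terms add \<open>y * p * (p - 1) / 2\<close>, which
  \<open>p\<^sup>2\<close> divides when \<open>p\<close> is odd. For \<open>p = 2\<close> the sum is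
  \<open>1 + x\<close>, and the hypothesis modulo 4 makes it 2 modulo 4.\<close>

lemma multiplicity_sum_power_prime:
  fixes x p :: int
  assumes p: "prime p" and px: "p dvd x - 1" and two: "p = 2 \<Longrightarrow> 4 dvd x - 1"
  shows "multiplicity p (\<Sum>i<nat p. x ^ i) = 1"
proof -
  have "p > 0" using p by (simp add: prime_gt_0_int)
  define y where "y = x - 1"
  have "[(\<Sum>i<nat p. x ^ i) = p] (mod p\<^sup>2)"
  proof (cases "p = 2")
    case True
    then have "(\<Sum>i<nat p. x ^ i) = 1 + x" by (simp add: numeral_2_eq_2)
    then show ?thesis using True two by (simp add: cong_iff_dvd_diff)
  next
    case False
    have "[(\<Sum>i<nat p. (1 + y) ^ i) = (\<Sum>i<nat p. 1 + int i * y)] (mod y\<^sup>2)"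
      by (intro cong_sum power_cong_linear)
    then have "[(\<Sum>i<nat p. x ^ i) = (\<Sum>i<nat p. 1 + int i * y)] (mod p\<^sup>2)"
      using px by (auto simp: y_def intro: cong_dvd_modulus)
    moreover have "(\<Sum>i<nat p. 1 + int i * y) = p + y * (\<Sum>i<nat p. int i)"
      using \<open>p > 0\<close> by (simp add: sum.distrib sum_distrib_left mult.commute)
    moreover have "p dvd (\<Sum>i<nat p. int i)"
    proof -
      have "2 * (\<Sum>i<n. int i) = int n * (int n - 1)" for n
        by (induction n) (auto simp: algebra_simps)
      from this[of "nat p"] have "2 * (\<Sum>i<nat p. int i) = p * (p - 1)"
        using \<open>p > 0\<close> by simp
      then have "p dvd 2 * (\<Sum>i<nat p. int i)" by (metis dvd_triv_left)
      moreover have "\<not> p dvd 2"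
        using False prime_gt_1_int[OF p] zdvd_not_zless[of 2 p] by linarith
      ultimately show ?thesis using p by (simp add: prime_dvd_mult_iff)
    qed
    then have "p\<^sup>2 dvd y * (\<Sum>i<nat p. int i)"
      unfolding power2_eq_square y_def by (intro mult_dvd_mono px)
    ultimately show ?thesis
      by (metis (no_types, lifting) cong_add_lcancel_0 cong_0_iff cong_trans)
  qed
  moreover have "p dvd p\<^sup>2" by simp
  ultimately have "p dvd (\<Sum>i<nat p. x ^ i)" "\<not> p\<^sup>2 dvd (\<Sum>i<nat p. x ^ i)"
    using \<open>p > 0\<close> p
    by (metis cong_dvd_iff cong_dvd_modulus dvd_refl,
        metis cong_dvd_iff dvd_refl not_prime_unit power2_eq_square dvd_times_left_cancel_iff mult_cancel_left2 less_irrefl mult.right_neutral)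
  then show ?thesis
    using p by (intro multiplicity_eqI) (auto simp: numeral_2_eq_2)
qed

text \<open>Strong induction on \<open>n\<close>. If \<open>p\<close> does not divide
  \<open>n\<close>, the cofactor of \<open>x - 1\<close> is congruent to \<open>n\<close> modulo
  \<open>p\<close>, hence prime to \<open>p\<close>. If \<open>n = p * k\<close>, passing from
  \<open>x ^ k - 1\<close> to \<open>x ^ n - 1\<close> adds a cofactor of multiplicity exactly
  1.\<close>

lemma multiplicity_power_minus_one:
  fixes x p :: int
  assumes p: "prime p" and px: "p dvd x - 1" and two: "p = 2 \<Longrightarrow> 4 dvd x - 1"
    and x: "x > 1" and n: "n > 0"
  shows "multiplicity p (x ^ n - 1) = multiplicity p (x - 1) + multiplicity p (int n)"
  using n
proof (induction n rule: less_induct)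
  case (less n)
  have pos: "p > 1" using p by (simp add: prime_gt_1_int)
  have gs: "z ^ k - 1 = (z - 1) * (\<Sum>i<k. z ^ i)" for z :: int and k
    by (simp add: power_diff_1_eq)
  \<comment> \<open>Additivity of \<open>multiplicity\<close> over a product requires nonzero
    factors; its value at 0 is 0 by default.\<close>
  have nz: "x ^ k - 1 \<noteq> 0" if "k > 0" for k
    using x that by (metis diff_eq_eq add_0 one_less_power less_irrefl)
  show ?case
  proof (cases "nat p dvd n")
    case False
    then have "\<not> p dvd int n" using pos
      by (metis int_dvd_int_iff int_nat_eq less_imp_le less_trans zero_less_one)
    moreover have "[(\<Sum>i<n. x ^ i) = int n] (mod p)"
      using px by (intro sum_power_cong) (simp add: cong_iff_dvd_diff)
    ultimately have "\<not> p dvd (\<Sum>i<n. x ^ i)" by (simp add: cong_dvd_iff)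
    then show ?thesis
      using \<open>\<not> p dvd int n\<close> nz[OF less.prems] gs[of x n] p x
      by (simp add: multiplicity_prime_elem_times_other[OF prime_imp_prime_elem] not_dvd_imp_multiplicity_0
          mult.commute[of "x - 1"])
  next
    case True
    then obtain k where k: "n = nat p * k" by auto
    have "k > 0" "k < n" using k less.prems pos by (auto simp: nat_mult_distrib)
    have dvdk: "x - 1 dvd x ^ k - 1" using gs by simp
    have "multiplicity p ((\<Sum>i<nat p. (x ^ k) ^ i)) = 1"
      using dvdk p px two by (intro multiplicity_sum_power_prime) (auto intro: dvd_trans)
    moreover have "x ^ n - 1 = (x ^ k - 1) * (\<Sum>i<nat p. (x ^ k) ^ i)"
      by (metis gs k mult.commute power_mult)
    ultimately have "multiplicity p (x ^ n - 1) = multiplicity p (x ^ k - 1) + 1"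
      using nz[OF \<open>k > 0\<close>] nz[OF less.prems] p
      by (simp add: prime_elem_multiplicity_mult_distrib[OF prime_imp_prime_elem])
    moreover have "int n = p * int k" using k pos by simp
    ultimately show ?thesis
      using less.IH[OF \<open>k < n\<close> \<open>k > 0\<close>] \<open>k > 0\<close> pos
      by (simp add: multiplicity_times_same)
  qed
qed

lemma multiplicity_int_int: "multiplicity (int p) (int n) = multiplicity p n"
proof -
  have "int p ^ k dvd int n \<longleftrightarrow> p ^ k dvd n" for k
    by (metis int_dvd_int_iff of_nat_power)
  moreover have "is_unit (int p) \<longleftrightarrow> is_unit p" by simp
  ultimately show ?thesis
    by (simp add: multiplicity_def)
qed

section \<open>Integers composed of primes in \<open>P\<close>\<close>

lemma N_P_pos: "m \<in> N_P P \<Longrightarrow> m > 0"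
  by (simp add: N_P_def)

lemma N_P_dvd: "m \<in> N_P P \<Longrightarrow> d dvd m \<Longrightarrow> d \<in> N_P P"
  unfolding N_P_def using dvd_pos_nat dvd_trans by blast

lemma N_P_dvdI:
  assumes "d \<in> N_P P" "n > 0" "\<And>p. p \<in> P \<Longrightarrow> prime p \<Longrightarrow> multiplicity p d \<le> multiplicity p n"
  shows "d dvd n"
proof (rule multiplicity_le_imp_dvd)
  show "d \<noteq> 0" using assms(1) by (simp add: N_P_def)
  fix p :: nat assume p: "prime p"
  show "multiplicity p d \<le> multiplicity p n"
  proof (cases "p \<in> P")
    case False
    then have "\<not> p dvd d" using assms(1) p by (auto simp: N_P_def)
    then show ?thesis by (simp add: not_dvd_imp_multiplicity_0)
  qed (use assms p in auto)
qed

section \<open>The number \<open>\<xi>\<close> and the constant \<open>M_P b P\<close>\<close>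

locale prime_base =
  fixes b :: nat and P :: "nat set"
  assumes b: "b \<ge> 2" and fin: "finite P"
    and prm: "p \<in> P \<Longrightarrow> prime p" and cop: "p \<in> P \<Longrightarrow> coprime p b"
begin

text \<open>The exponent \<open>ord (Q_P P) b\<close> gives a power congruent to 1 modulo every
  prime of \<open>P\<close>; doubling it gives a square, hence 1 modulo 4 if
  \<open>2 \<in> P\<close>. These are the conditions for lifting the exponent.\<close>

definition \<xi> where "\<xi> = b ^ (2 * ord (Q_P P) b)"

lemma Q_pos: "Q_P P > 0"
  unfolding Q_P_def using prm by (intro prod_pos) (auto intro: prime_gt_0_nat)

lemma prime_le_Q: "p \<in> P \<Longrightarrow> p \<le> Q_P P"
  using Q_pos dvd_imp_le[of p "Q_P P"] dvd_prodI[OF fin, of p "\<lambda>p. p"] by (simp add: Q_P_def)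

lemma coprime_N_P: "m \<in> N_P P \<Longrightarrow> coprime m b"
proof (rule ccontr)
  assume m: "m \<in> N_P P" and "\<not> coprime m b"
  then have "gcd m b \<noteq> 1" by (metis coprime_iff_gcd_eq_1)
  then obtain p where "prime p" "p dvd gcd m b" using prime_factor_nat by blast
  then have "prime p" "p dvd m" "p dvd b" by auto
  moreover have "p \<in> P" using m calculation by (simp add: N_P_def)
  ultimately show False using cop[of p] by (metis coprime_absorb_left not_prime_unit)
qed

lemma ord_Q_pos: "ord (Q_P P) b > 0"
proof -
  have "coprime (Q_P P) b"
    unfolding Q_P_def by (intro prod_coprime_left cop)
  then show ?thesis by simp
qed

lemma xi_gt_1: "\<xi> > 1"
  unfolding \<xi>_def using b ord_Q_pos by (intro one_less_power) auto

lemma prime_dvd_xi: "p \<in> P \<Longrightarrow> p dvd \<xi> - 1"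
proof -
  assume p: "p \<in> P"
  have "[b ^ ord (Q_P P) b = 1] (mod Q_P P)" by (rule ord)
  moreover have "p dvd Q_P P" unfolding Q_P_def using p fin by (rule dvd_prodI[rotated])
  ultimately have "[b ^ ord (Q_P P) b = 1] (mod p)" by (rule cong_dvd_modulus_nat)
  from cong_pow[OF this, of 2] have "[\<xi> = 1] (mod p)"
    by (simp add: \<xi>_def power_mult[symmetric] mult.commute)
  then show ?thesis using xi_gt_1 by (metis cong_to_1_nat)
qed

lemma four_dvd_xi: "2 \<in> P \<Longrightarrow> 4 dvd \<xi> - 1"
proof -
  assume "2 \<in> P"
  define y where "y = b ^ ord (Q_P P) b"
  have "odd b" using cop[OF \<open>2 \<in> P\<close>] by simp
  then have "odd y" by (simp add: y_def)
  then obtain z where z: "y = 2 * z + 1" by (auto elim: oddE)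
  have "\<xi> = y\<^sup>2" by (simp add: \<xi>_def y_def power_mult[symmetric] mult.commute)
  also have "\<dots> = 4 * (z * z + z) + 1" by (simp add: z power2_eq_square algebra_simps)
  finally show ?thesis by simp
qed

lemma M_pos: "M_P b P > 0"
  unfolding M_P_def using prm by (intro prod_pos) (auto intro: prime_gt_0_nat)

text \<open>\<open>M_P b P\<close> is the part of \<open>\<xi> - 1\<close> composed of primes in
  \<open>P\<close>, so its exponents are the constant terms in the lifting formula.\<close>

lemma multiplicity_M: "p \<in> P \<Longrightarrow> multiplicity p (M_P b P) = multiplicity p (\<xi> - 1)"
  unfolding M_P_def \<xi>_def using multiplicity_prod_prime_powers[OF fin prm, of p] by (simp add: prm)

lemma multiplicity_M_pos: "p \<in> P \<Longrightarrow> multiplicity p (M_P b P) > 0"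
  using prime_dvd_xi[of p] xi_gt_1 prm[of p]
  by (simp add: multiplicity_M prime_multiplicity_gt_zero_iff)

lemma multiplicity_xi_power:
  assumes p: "p \<in> P" and h: "h > 0"
  shows "multiplicity p (\<xi> ^ h - 1) = multiplicity p (M_P b P) + multiplicity p h"
proof -
  have "multiplicity (int p) (int \<xi> ^ h - 1) = multiplicity (int p) (int \<xi> - 1) + multiplicity (int p) (int h)"
  proof (rule multiplicity_power_minus_one)
    have *: "int (\<xi> - 1) = int \<xi> - 1" using xi_gt_1 by simp
    show "int p dvd int \<xi> - 1" using prime_dvd_xi[OF p] unfolding *[symmetric] by simp
    show "4 dvd int \<xi> - 1" if "int p = 2"
    proof -
      have "2 \<in> P" using that p by (metis of_nat_eq_iff of_nat_numeral)
      from four_dvd_xi[OF this] have "int 4 dvd int (\<xi> - 1)" by (simp only: int_dvd_int_iff)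
      then show ?thesis by (simp only: * of_nat_numeral)
    qed
  qed (use prm[OF p] xi_gt_1 h in auto)
  moreover have "int \<xi> ^ h - 1 = int (\<xi> ^ h - 1)" "int \<xi> - 1 = int (\<xi> - 1)"
    using xi_gt_1 by (auto simp: of_nat_diff)
  ultimately show ?thesis unfolding multiplicity_M[OF p] by (simp only: multiplicity_int_int)
qed

text \<open>Raising \<open>b ^ h = 1\<close> modulo \<open>d\<close> to the power
  \<open>2 * ord (Q_P P) b\<close> gives \<open>\<xi> ^ h = 1\<close>, where the multiplicities are
  known exactly. Up to the constant \<open>M_P b P\<close>, a divisor of \<open>b ^ h - 1\<close>
  must divide \<open>h\<close>, which later makes large gcds rare.\<close>

lemma N_P_dvd_power_minus_one:
  assumes d: "d \<in> N_P P" and h: "h > 0" and dvd: "d dvd b ^ h - 1"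
  shows "d dvd M_P b P * h"
proof (rule N_P_dvdI[OF d])
  show "M_P b P * h > 0" using M_pos h by simp
  fix p assume p: "p \<in> P" "prime p"
  have "\<xi> ^ h - 1 > 0" using xi_gt_1 h by (simp add: one_less_power del: One_nat_def)
  have "[b ^ h = 1] (mod d)"
    using dvd b by (metis cong_altdef_nat one_le_power le_trans one_le_numeral)
  from cong_pow[OF this, of "2 * ord (Q_P P) b"] have "[\<xi> ^ h = 1] (mod d)"
    by (simp add: \<xi>_def power_mult[symmetric] mult.commute)
  then have "d dvd \<xi> ^ h - 1" using cong_to_1_nat by blast
  then have "multiplicity p d \<le> multiplicity p (\<xi> ^ h - 1)"
    using \<open>\<xi> ^ h - 1 > 0\<close> by (intro dvd_imp_multiplicity_le) auto
  also have "\<dots> = multiplicity p (M_P b P * h)"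
    using multiplicity_xi_power[OF p(1) h] p h M_pos by (simp add: prime_elem_multiplicity_mult_distrib[OF prime_imp_prime_elem])
  finally show "multiplicity p d \<le> multiplicity p (M_P b P * h)" .
qed

text \<open>The exponent \<open>h\<close> is a multiple of \<open>2 * ord (Q_P P) b\<close> by exactly the factor that
  brings every prime up to its exponent in \<open>m div p\<close>.\<close>

lemma exists_exact_exponent:
  assumes m: "m \<in> N_P P" and "\<not> m dvd M_P b P"
  obtains p h where "p \<in> P" "p dvd m" "p dvd m div p" "m div p dvd b ^ h - 1" "\<not> m dvd b ^ h - 1"
proof -
  obtain p where p: "p \<in> P" "prime p" "multiplicity p (M_P b P) < multiplicity p m"
    using N_P_dvdI[OF m M_pos] assms(2) by (meson not_le)
  define m1 where "m1 = m div p"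
  have "p dvd m" using p by (metis not_dvd_imp_multiplicity_0 not_less0)
  then have mm: "m = p * m1" by (simp add: m1_def)
  have "m > 0" using N_P_pos m by blast
  then have "m1 > 0" using mm by simp
  have m1P: "m1 \<in> N_P P" using N_P_dvd[OF m] mm by simp
  have mp: "multiplicity p m = Suc (multiplicity p m1)"
    unfolding mm using \<open>m1 > 0\<close> p not_prime_unit by (intro multiplicity_times_same) auto
  define G where "G = gcd (M_P b P) m1"
  define g where "g = m1 div G"
  have Gg: "m1 = G * g" by (simp add: g_def G_def)
  then have gpos: "g > 0" and Gpos: "G > 0" using \<open>m1 > 0\<close> by simp_all
  have mg: "multiplicity q m1 = min (multiplicity q (M_P b P)) (multiplicity q m1) + multiplicity q g"
    if "prime q" for q
  proof -
    have "multiplicity q m1 = multiplicity q G + multiplicity q g"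
      unfolding Gg using gpos Gpos that
      by (intro prime_elem_multiplicity_mult_distrib) auto
    then show ?thesis using that M_pos \<open>m1 > 0\<close> by (simp add: G_def multiplicity_gcd)
  qed
  have pos: "\<xi> ^ g - 1 > 0" using xi_gt_1 gpos by (simp add: one_less_power del: One_nat_def)
  have "m1 dvd \<xi> ^ g - 1"
  proof (rule N_P_dvdI[OF m1P pos])
    fix q assume q: "q \<in> P" "prime q"
    show "multiplicity q m1 \<le> multiplicity q (\<xi> ^ g - 1)"
      using mg[OF q(2)] multiplicity_xi_power[OF q(1) gpos] by linarith
  qed
  \<comment> \<open>At the chosen \<open>p\<close> the multiplicity of \<open>\<xi> ^ g - 1\<close>
    equals that of \<open>m1\<close>, one less than that of \<open>m\<close>, because
    \<open>M_P b P\<close> has at most the multiplicity of \<open>m1\<close> there.\<close>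
  moreover have "\<not> m dvd \<xi> ^ g - 1"
  proof
    assume "m dvd \<xi> ^ g - 1"
    then have "multiplicity p m \<le> multiplicity p (\<xi> ^ g - 1)"
      using pos by (intro dvd_imp_multiplicity_le) auto
    then show False
      using mg[OF p(2)] multiplicity_xi_power[OF p(1) gpos] mp p(3) by linarith
  qed
  \<comment> \<open>The multiplicity of \<open>p\<close> in \<open>m1\<close> is at least its
    multiplicity in \<open>M_P b P\<close>, which is positive.\<close>
  moreover have "p dvd m1"
    using mp p(3) multiplicity_M_pos[OF p(1)] by (metis not_dvd_imp_multiplicity_0 less_Suc_eq_le not_less0 leD)
  moreover have "\<xi> ^ g = b ^ (2 * ord (Q_P P) b * g)" by (simp add: \<xi>_def power_mult)
  ultimately show ?thesis
    using p \<open>p dvd m\<close> by (intro that[of p "2 * ord (Q_P P) b * g"]) (simp_all add: m1_def)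
qed

end

section \<open>Additive characters\<close>

text \<open>The character y -> e(y/m), taken on integers so that congruences and divisibility modulo
  \<open>m\<close> apply directly.\<close>

definition addchar :: "nat \<Rightarrow> int \<Rightarrow> complex" where
  "addchar m y = e_2pi (of_int y / of_nat m)"

lemma addchar_add: "addchar m (y + z) = addchar m y * addchar m z"
  by (simp add: addchar_def e_2pi_def exp_add[symmetric] ring_distribs add_divide_distrib)

lemma addchar_0 [simp]: "addchar m 0 = 1"
  by (simp add: addchar_def e_2pi_def)

lemma addchar_exp: "addchar m y = exp (\<i> * of_real (2 * pi * of_int y / of_nat m))"
  by (simp add: addchar_def e_2pi_def mult_ac)

lemma norm_addchar [simp]: "norm (addchar m y) = 1"
  unfolding addchar_exp by (rule norm_exp_i_times)

lemma cnj_addchar: "cnj (addchar m y) = addchar m (- y)"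
  by (simp add: addchar_def e_2pi_def exp_cnj)

lemma addchar_diff: "addchar m (y - z) = addchar m y * cnj (addchar m z)"
  using addchar_add[of m y "- z"] by (simp add: cnj_addchar)

lemma addchar_power: "addchar m y ^ n = addchar m (int n * y)"
  by (induction n) (simp_all add: ring_distribs addchar_add)

lemma addchar_scale: "d > 0 \<Longrightarrow> addchar (d * m) (int d * y) = addchar m y"
  by (simp add: addchar_def)

lemma addchar_eq_1_iff:
  assumes "m > 0"
  shows "addchar m y = 1 \<longleftrightarrow> int m dvd y"
proof -
  have "addchar m y = 1 \<longleftrightarrow> (\<exists>n::int. 2 * pi * of_int y / of_nat m = of_int (2 * n) * pi)"
    unfolding addchar_exp exp_eq_1 by simp
  also have "\<dots> \<longleftrightarrow> (\<exists>n::int. y = int m * n)"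
  proof (rule ex_cong1)
    fix n :: int
    have "2 * pi * of_int y / of_nat m = of_int (2 * n) * pi \<longleftrightarrow> real_of_int y = of_int (int m * n)"
      using assms by (simp add: field_simps)
    then show "2 * pi * of_int y / of_nat m = of_int (2 * n) * pi \<longleftrightarrow> y = int m * n"
      by (simp only: of_int_eq_iff)
  qed
  finally show ?thesis by (simp add: dvd_def)
qed

lemma addchar_cong:
  assumes "[y = z] (mod int m)"
  shows "addchar m y = addchar m z"
proof (cases "m = 0")
  case False
  then have "addchar m (y - z) = 1"
    using assms by (simp add: addchar_eq_1_iff cong_iff_dvd_diff)
  then show ?thesis using addchar_add[of m "y - z" z] by simp
qed (use assms in \<open>simp add: cong_def\<close>)

text \<open>Orthogonality of characters: the summands form a geometric progression whose ratio is an
  \<open>m\<close>-th root of unity.\<close>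

lemma sum_addchar:
  assumes "m > 0"
  shows "(\<Sum>c<m. addchar m (int c * y)) = (if int m dvd y then of_nat m else 0)"
proof (cases "int m dvd y")
  case True
  then have "addchar m (int c * y) = 1" for c
    using assms by (simp add: addchar_eq_1_iff)
  then show ?thesis using True by simp
next
  case False
  then have "addchar m y \<noteq> 1" using assms by (simp add: addchar_eq_1_iff)
  then have "(\<Sum>c<m. addchar m y ^ c) = (addchar m y ^ m - 1) / (addchar m y - 1)"
    by (rule geometric_sum)
  moreover have "addchar m y ^ m = 1"
    using assms by (simp add: addchar_power addchar_eq_1_iff)
  ultimately show ?thesis using False by (simp add: addchar_power)
qed

text \<open>Expanding the square and summing over \<open>c\<close> first, orthogonality keeps only
  pairs with \<open>g i\<close> and \<open>g j\<close> congruent, and by injectivity these are the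
  diagonal ones.\<close>

lemma parseval_addchar:
  assumes m: "m > 0" and I: "finite I"
    and inj: "\<And>i j. i \<in> I \<Longrightarrow> j \<in> I \<Longrightarrow> [g i = g j] (mod int m) \<Longrightarrow> i = j"
  shows "(\<Sum>c<m. (norm (\<Sum>i\<in>I. addchar m (int c * g i) * w i))\<^sup>2) = real m * (\<Sum>i\<in>I. (norm (w i))\<^sup>2)"
proof -
  have "complex_of_real (\<Sum>c<m. (norm (\<Sum>i\<in>I. addchar m (int c * g i) * w i))\<^sup>2)
      = (\<Sum>c<m. (\<Sum>i\<in>I. addchar m (int c * g i) * w i) * cnj (\<Sum>i\<in>I. addchar m (int c * g i) * w i))"
    by (simp only: of_real_sum complex_norm_square)
  also have "\<dots> = (\<Sum>c<m. \<Sum>i\<in>I. \<Sum>j\<in>I. addchar m (int c * (g i - g j)) * (w i * cnj (w j)))"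
    by (simp add: sum_product right_diff_distrib addchar_diff mult_ac)
  also have "\<dots> = (\<Sum>i\<in>I. \<Sum>c<m. \<Sum>j\<in>I. addchar m (int c * (g i - g j)) * (w i * cnj (w j)))"
    by (rule sum.swap)
  also have "\<dots> = (\<Sum>i\<in>I. \<Sum>j\<in>I. \<Sum>c<m. addchar m (int c * (g i - g j)) * (w i * cnj (w j)))"
    by (intro sum.cong refl sum.swap)
  also have "\<dots> = (\<Sum>i\<in>I. \<Sum>j\<in>I. if i = j then of_nat m * (w i * cnj (w i)) else 0)"
  proof (intro sum.cong refl)
    fix i j assume "i \<in> I" "j \<in> I"
    then have "int m dvd g i - g j \<longleftrightarrow> i = j"
      using inj by (auto simp: cong_iff_dvd_diff)
    then show "(\<Sum>c<m. addchar m (int c * (g i - g j)) * (w i * cnj (w j)))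
        = (if i = j then of_nat m * (w i * cnj (w i)) else 0)"
      by (simp only: sum_distrib_right[symmetric] sum_addchar[OF m]) simp
  qed
  also have "\<dots> = complex_of_real (real m * (\<Sum>i\<in>I. (norm (w i))\<^sup>2))"
    using I by (simp add: sum_distrib_left complex_norm_square del: of_real_power)
  finally show ?thesis by (simp only: of_real_eq_iff)
qed

text \<open>Multiplying the coefficient by \<open>b\<close> shifts the index by one, which changes
  the sum only by a factor of norm 1. Hence \<open>T\<close> distinct coefficients share the same
  norm, while Parseval bounds the sum of the squared norms over all residues by
  \<open>m * T\<close>.\<close>

lemma norm_complete_sum_le:
  fixes a c :: int and b m :: nat
  assumes m: "m > 0" and mb: "coprime m b" and am: "coprime a (int m)"
  defines "T \<equiv> ord m b"
  shows "norm (\<Sum>n<T. addchar m (a * int b ^ n) * addchar T (c * int n)) \<le> sqrt (real m)"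
proof -
  have T: "T > 0" using mb by (simp add: T_def)
  define F where "F y = (\<Sum>n<T. addchar m (y * int b ^ n) * addchar T (c * int n))" for y
  have bT: "[int b ^ T = 1] (mod int m)"
    using ord[of b m] unfolding T_def by (metis cong_int_iff of_nat_1 of_nat_power)
  have shift: "norm (F (y * int b)) = norm (F y)" for y
  proof -
    define h where "h n = addchar m (y * int b ^ n) * addchar T (c * int n)" for n
    have "addchar T c * F (y * int b) = (\<Sum>n<T. h (Suc n))"
      unfolding F_def h_def sum_distrib_left
      by (intro sum.cong refl) (simp add: ring_distribs addchar_add mult_ac)
    moreover have "(\<Sum>n<T. h (Suc n)) + h 0 = (\<Sum>n<T. h n) + h T"
      using sum.lessThan_Suc_shift[of h T] sum.lessThan_Suc[of h T] by (simp add: add.commute)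
    moreover have "h T = h 0"
    proof -
      have "addchar m (y * int b ^ T) = addchar m (y * 1)"
        by (intro addchar_cong cong_mult cong_refl bT)
      moreover have "addchar T (c * int T) = 1" using T by (simp add: addchar_eq_1_iff)
      ultimately show ?thesis by (simp add: h_def)
    qed
    ultimately have "addchar T c * F (y * int b) = F y" by (simp add: F_def h_def)
    then show ?thesis by (metis norm_mult norm_addchar mult_1)
  qed
  have Fa: "norm (F (a * int b ^ j)) = norm (F a)" for j
  proof (induction j)
    case (Suc j)
    then show ?case using shift[of "a * int b ^ j"] by (simp add: mult_ac)
  qed simp
  define r where "r j = nat (a * int b ^ j mod int m)" for j
  have r: "int (r j) = a * int b ^ j mod int m" for j using m by (simp add: r_def)
  have rm: "r j < m" for j
    using m pos_mod_bound[of "int m" "a * int b ^ j"] r[of j] by linarith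
  have Fr: "norm (F (int (r j))) = norm (F a)" for j
  proof -
    have "F (int (r j)) = F (a * int b ^ j)"
      unfolding F_def
      by (intro sum.cong refl arg_cong2[where f = "(*)"] addchar_cong cong_mult cong_refl)
        (simp add: r cong_def)
    then show ?thesis using Fa by simp
  qed
  have bpow: "i = j" if "i < T" "j < T" "[int b ^ i = int b ^ j] (mod int m)" for i j
  proof -
    have "[b ^ i = b ^ j] (mod m)" using that(3) by (metis cong_int_iff of_nat_power)
    then have "[i = j] (mod T)" unfolding T_def using mb order_divides_expdiff by blast
    then show ?thesis using that by (simp add: cong_def)
  qed
  have inj: "inj_on r {..<T}"
  proof (rule inj_onI)
    fix i j assume "i \<in> {..<T}" "j \<in> {..<T}" "r i = r j"
    then have "[a * int b ^ i = a * int b ^ j] (mod int m)" using r by (metis cong_def)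
    then have "[int b ^ i = int b ^ j] (mod int m)" using am by (simp add: cong_mult_lcancel)
    then show "i = j" using bpow \<open>i \<in> {..<T}\<close> \<open>j \<in> {..<T}\<close> by simp
  qed
  have "real T * (norm (F a))\<^sup>2 = (\<Sum>j<T. (norm (F (int (r j))))\<^sup>2)" by (simp add: Fr)
  also have "\<dots> = (\<Sum>y\<in>r ` {..<T}. (norm (F (int y)))\<^sup>2)" by (simp add: sum.reindex[OF inj])
  \<comment> \<open>Enlarging the orbit of \<open>a\<close> to all residues lets Parseval apply,
    with the \<open>T\<close> distinct powers of \<open>b\<close> as frequencies and weights of norm
    1.\<close>
  also have "\<dots> \<le> (\<Sum>y<m. (norm (F (int y)))\<^sup>2)" by (intro sum_mono2) (use rm in auto)
  also have "\<dots> = real m * (\<Sum>n<T. (norm (addchar T (c * int n)))\<^sup>2)"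
    unfolding F_def by (intro parseval_addchar m) (use bpow in auto)
  also have "\<dots> = real T * real m" by simp
  finally have "(norm (F a))\<^sup>2 \<le> real m" using T by simp
  then show ?thesis unfolding F_def by (intro real_le_rsqrt)
qed

section \<open>Completing incomplete sums\<close>

text \<open>On the first half the sine lies above its chord by concavity; the second half follows by
  reflection. The parabola is chosen because \<open>1 / (t * (1 - t))\<close> splits into
  \<open>1 / t + 1 / (1 - t)\<close>.\<close>

lemma sin_pi_ge:
  fixes t :: real
  assumes "0 \<le> t" "t \<le> 1"
  shows "2 * t * (1 - t) \<le> sin (pi * t)"
proof -
  have half: "2 * s * (1 - s) \<le> sin (pi * s)" if "0 \<le> s" "s \<le> 1 / 2" for s :: real
  proof -
    have "convex_on {0..pi/2} (\<lambda>y. - sin y)"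
      by (rule f''_ge0_imp_convex[where f' = "\<lambda>y. - cos y" and f'' = sin])
        (auto intro!: derivative_eq_intros sin_ge_zero)
    from convex_onD[OF this, of "2 * s" 0 "pi / 2"] that
    have "2 * s \<le> sin (pi * s)" by (simp add: mult_ac)
    moreover have "2 * s * (1 - s) \<le> 2 * s * 1" using that by (intro mult_left_mono) auto
    ultimately show ?thesis by simp
  qed
  show ?thesis
  proof (cases "t \<le> 1 / 2")
    case False
    have "sin (pi * (1 - t)) = sin (pi * t)" by (simp add: right_diff_distrib sin_diff)
    then show ?thesis using half[of "1 - t"] assms False by (simp add: mult_ac)
  qed (use half assms in auto)
qed

text \<open>Geometric sum with ratio \<open>z\<close>: the numerator has norm at most 2, and
  \<open>norm (z - 1)\<close> is twice the sine of \<open>pi * c / T\<close>, bounded below by the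
  parabola. Partial fractions give the stated form.\<close>

lemma norm_sum_addchar_le:
  assumes c: "0 < c" "c < T"
  shows "norm (\<Sum>n=1..N. addchar T (int c * int n)) \<le> real T / 2 * (1 / real c + 1 / real (T - c))"
proof -
  define z where "z = addchar T (int c)"
  define t where "t = real c / real T"
  have t: "0 < t" "t < 1" using c by (auto simp: t_def)
  have z1: "norm (z - 1) = 2 * \<bar>sin (pi * t)\<bar>"
    unfolding z_def addchar_exp dist_exp_i_1 by (simp add: t_def)
  have "2 * (2 * t * (1 - t)) \<le> norm (z - 1)"
    using sin_pi_ge[of t] t unfolding z1 by simp
  moreover have "2 * t * (1 - t) > 0" using t by simp
  ultimately have low: "4 * t * (1 - t) \<le> norm (z - 1)" "z \<noteq> 1" by auto
  have "(\<Sum>n=1..N. addchar T (int c * int n)) = (\<Sum>n<N. z * z ^ n)"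
    by (rule sum.reindex_bij_witness[of _ Suc "\<lambda>n. n - 1"])
      (auto simp: z_def addchar_power addchar_add[symmetric] algebra_simps of_nat_diff)
  also have "\<dots> = z * ((z ^ N - 1) / (z - 1))"
    using low by (simp add: sum_distrib_left[symmetric] geometric_sum)
  also have "norm \<dots> = norm (z ^ N - 1) / norm (z - 1)"
    by (simp add: norm_mult norm_divide z_def)
  also have "\<dots> \<le> 2 / (4 * t * (1 - t))"
  proof (rule frac_le)
    show "norm (z ^ N - 1) \<le> 2"
      using norm_triangle_ineq4[of "z ^ N" 1] by (simp add: z_def norm_power)
  qed (use low t in auto)
  also have "\<dots> = real T / 2 * (1 / real c + 1 / real (T - c))"
    using c by (simp add: t_def field_simps of_nat_diff)
  finally show ?thesis .
qed

text \<open>Completion: \<open>f\<close> is expanded in characters modulo \<open>T\<close>. The zero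
  frequency vanishes by hypothesis, every other coefficient is at most \<open>K\<close>, and the
  geometric sums add up to \<open>T\<close> times a harmonic sum.\<close>

lemma norm_incomplete_sum_le:
  fixes f :: "nat \<Rightarrow> complex"
  assumes T: "T > 0" and per: "\<And>n. f (n + T) = f n"
    and zero: "(\<Sum>n<T. f n) = 0"
    and K: "\<And>c::int. norm (\<Sum>n<T. f n * addchar T (c * int n)) \<le> K"
  shows "norm (\<Sum>n=1..N. f n) \<le> K * (1 + ln (real T))"
proof -
  define F where "F c = (\<Sum>n<T. f n * addchar T (- int c * int n))" for c
  have K0: "K \<ge> 0" using K[of 0] norm_ge_zero order_trans by blast
  have pmod: "f (n mod T) = f n" for n
  proof -
    have "f (n + k * T) = f n" for n k
      by (induction k) (auto simp: per add.assoc[symmetric] add.commute[of T])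
    from this[of "n mod T" "n div T"] show ?thesis by simp
  qed
  \<comment> \<open>Fourier inversion modulo \<open>T\<close>, with the unnormalised coefficients
    \<open>F c\<close>.\<close>
  have inv: "of_nat T * f n = (\<Sum>c<T. F c * addchar T (int c * int n))" for n
  proof -
    have "(\<Sum>c<T. F c * addchar T (int c * int n))
        = (\<Sum>c<T. \<Sum>k<T. addchar T (int c * (int n - int k)) * f k)"
      unfolding F_def sum_distrib_right
      by (intro sum.cong refl) (simp add: right_diff_distrib addchar_diff cnj_addchar mult_ac)
    also have "\<dots> = (\<Sum>k<T. \<Sum>c<T. addchar T (int c * (int n - int k)) * f k)"
      by (rule sum.swap)
    also have "\<dots> = (\<Sum>k<T. if k = n mod T then of_nat T * f k else 0)"
    proof (intro sum.cong refl)
      fix k assume k: "k \<in> {..<T}"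
      have "int T dvd int n - int k \<longleftrightarrow> [n = k] (mod T)"
        by (simp add: cong_iff_dvd_diff[symmetric] cong_int_iff)
      also have "\<dots> \<longleftrightarrow> k = n mod T" using k by (auto simp: cong_def)
      finally show "(\<Sum>c<T. addchar T (int c * (int n - int k)) * f k)
          = (if k = n mod T then of_nat T * f k else 0)"
        by (simp only: sum_distrib_right[symmetric] sum_addchar[OF T]) simp
    qed
    also have "\<dots> = of_nat T * f n" using T by (simp add: pmod)
    finally show ?thesis ..
  qed
  have F0: "F 0 = 0" using zero by (simp add: F_def)
  have "of_nat T * (\<Sum>n=1..N. f n) = (\<Sum>n=1..N. \<Sum>c<T. F c * addchar T (int c * int n))"
    by (simp only: sum_distrib_left inv)
  also have "\<dots> = (\<Sum>c<T. F c * (\<Sum>n=1..N. addchar T (int c * int n)))"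
    unfolding sum_distrib_left by (rule sum.swap)
  also have "\<dots> = (\<Sum>c\<in>{1..<T}. F c * (\<Sum>n=1..N. addchar T (int c * int n)))"
    by (rule sum.mono_neutral_right) (use F0 in \<open>auto simp: not_le less_Suc_eq\<close>)
  finally have eq: "of_nat T * (\<Sum>n=1..N. f n)
      = (\<Sum>c\<in>{1..<T}. F c * (\<Sum>n=1..N. addchar T (int c * int n)))" .
  have "real T * norm (\<Sum>n=1..N. f n) = norm (of_nat T * (\<Sum>n=1..N. f n))"
    by (simp add: norm_mult)
  also have "\<dots> \<le> (\<Sum>c\<in>{1..<T}. K * (real T / 2 * (1 / real c + 1 / real (T - c))))"
    unfolding eq
  proof (rule sum_norm_le)
    fix c assume c: "c \<in> {1..<T}"
    have "norm (F c) \<le> K" using K[of "- int c"] by (simp add: F_def)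
    moreover have "norm (\<Sum>n=1..N. addchar T (int c * int n)) \<le> real T / 2 * (1 / real c + 1 / real (T - c))"
      using c by (intro norm_sum_addchar_le) auto
    ultimately show "norm (F c * (\<Sum>n=1..N. addchar T (int c * int n)))
        \<le> K * (real T / 2 * (1 / real c + 1 / real (T - c)))"
      unfolding norm_mult using K0 by (intro mult_mono) auto
  qed
  also have "\<dots> = K * (real T / 2) * ((\<Sum>c\<in>{1..<T}. 1 / real c) + (\<Sum>c\<in>{1..<T}. 1 / real (T - c)))"
    by (simp only: sum_distrib_left[symmetric] sum.distrib mult.assoc)
  \<comment> \<open>The reflection \<open>c\<close> to \<open>T - c\<close> makes the two halves
    equal, which cancels the factor 1/2.\<close>
  also have "(\<Sum>c\<in>{1..<T}. 1 / real (T - c)) = (\<Sum>c\<in>{1..<T}. 1 / real c)"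
    by (rule sum.reindex_bij_witness[of _ "\<lambda>c. T - c" "\<lambda>c. T - c"]) auto
  also have "(\<Sum>c\<in>{1..<T}. 1 / real c) \<le> 1 + ln (real T)"
  proof -
    have "(\<Sum>c\<in>{1..<T}. 1 / real c) \<le> (\<Sum>c\<in>{1..T}. 1 / real c)"
      by (intro sum_mono2) auto
    also have "\<dots> = harm T" by (simp add: harm_def divide_inverse)
    \<comment> \<open>\<open>harm n - ln n\<close> is decreasing and equals 1 at
      \<open>n = 1\<close>.\<close>
    also have "\<dots> \<le> 1 + ln (real T)"
      using euler_mascheroni_sequence_decreasing[of 1 T] T by (simp add: harm_def)
    finally show ?thesis .
  qed
  finally have "real T * norm (\<Sum>n=1..N. f n)
      \<le> K * (real T / 2) * ((1 + ln (real T)) + (1 + ln (real T)))"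
    using K0 by (simp add: mult_left_mono add_mono)
  then have "real T * norm (\<Sum>n=1..N. f n) \<le> real T * (K * (1 + ln (real T)))"
    by (simp add: algebra_simps)
  then show ?thesis using T by simp
qed

lemma sum_periodic_shift:
  fixes f :: "nat \<Rightarrow> 'a :: ab_group_add"
  assumes per: "\<And>n. f (n + T) = f n"
  shows "(\<Sum>n<T. f (n + k)) = (\<Sum>n<T. f n)"
proof (induction k)
  case (Suc k)
  have "(\<Sum>n<T. f (Suc n + k)) + f k = (\<Sum>n<T. f (n + k)) + f (T + k)"
    using sum.lessThan_Suc_shift[of "\<lambda>n. f (n + k)" T] sum.lessThan_Suc[of "\<lambda>n. f (n + k)" T]
    by (simp add: add.commute)
  moreover have "f (T + k) = f k" using per[of k] by (simp add: add.commute)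
  ultimately show ?case using Suc by simp
qed simp

section \<open>The exponential sums and their bound for \<open>k = 0\<close>\<close>

context prime_base
begin

definition expsum :: "int \<Rightarrow> nat \<Rightarrow> nat \<Rightarrow> complex" where
  "expsum a m N = (\<Sum>n=1..N. addchar m (a * int b ^ n))"

lemma int_power_minus_one: "int (b ^ h - 1) = int b ^ h - 1"
  using b by (simp add: of_nat_diff)

text \<open>Shifting \<open>n\<close> by the exponent \<open>h\<close> multiplies the summand by a nontrivial \<open>p\<close>-th root
  of unity that is itself invariant under this shift, so the sum over a period splits into
  vanishing geometric sums.\<close>

lemma complete_sum_eq_0:
  assumes m: "m \<in> N_P P" and ndvd: "\<not> m dvd M_P b P" and a: "coprime a (int m)"
  shows "(\<Sum>n<ord m b. addchar m (a * int b ^ n)) = 0"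
proof -
  obtain p h where ph: "p \<in> P" "p dvd m" "p dvd m div p" "m div p dvd b ^ h - 1" "\<not> m dvd b ^ h - 1"
    by (rule exists_exact_exponent[OF m ndvd])
  define m1 where "m1 = m div p"
  have mm: "m = p * m1" using ph(2) by (simp add: m1_def)
  have p: "prime p" "p > 0" using prm[OF ph(1)] prime_gt_0_nat by auto
  have m1: "m1 > 0" using N_P_pos[OF m] mm by simp
  obtain u where u: "b ^ h - 1 = m1 * u" using ph(4) by (auto simp: m1_def)
  have pu: "\<not> p dvd u" using ph(5) unfolding u mm by (auto simp: mult.commute[of p])
  have bh: "int b ^ h = 1 + int m1 * int u"
    using int_power_minus_one[of h] unfolding u by simp
  define T where "T = ord m b"
  define f where "f n = addchar m (a * int b ^ n)" for n
  define z where "z n = addchar p (a * int b ^ n * int u)" for n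
  have bT: "[int b ^ T = 1] (mod int m)"
    using ord[of b m] unfolding T_def by (metis cong_int_iff of_nat_1 of_nat_power)
  have per: "f (n + T) = f n" for n
  proof -
    have "[a * int b ^ n * int b ^ T = a * int b ^ n * 1] (mod int m)"
      by (intro cong_mult cong_refl bT)
    then show ?thesis unfolding f_def by (intro addchar_cong) (simp add: power_add mult_ac)
  qed
  have fh: "f (n + h) = f n * z n" for n
  proof -
    \<comment> \<open>The increment has the factor \<open>m1\<close>, and \<open>m = p * m1\<close>,
      so its phase is a fraction with denominator \<open>p\<close>.\<close>
    have "a * int b ^ (n + h) = a * int b ^ n + int m1 * (a * int b ^ n * int u)"
      by (simp add: power_add bh algebra_simps)
    then show ?thesis
      using addchar_scale[OF m1, of p "a * int b ^ n * int u"]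
      by (simp add: f_def z_def addchar_add mm mult.commute[of p])
  qed
  have zh: "z (n + h) = z n" for n
  proof -
    \<comment> \<open>Since \<open>p\<close> divides \<open>m1\<close>, the power
      \<open>b ^ h\<close> is 1 modulo \<open>p\<close>, so \<open>z\<close> does not see the
      shift.\<close>
    obtain v where v: "m1 = p * v" using ph(3) by (auto simp: m1_def)
    have "a * int b ^ (n + h) * int u - a * int b ^ n * int u = int p * (a * int b ^ n * int u * int v * int u)"
      by (simp add: power_add bh v algebra_simps)
    then have "[a * int b ^ (n + h) * int u = a * int b ^ n * int u] (mod int p)"
      unfolding cong_iff_dvd_diff by (metis dvd_triv_left)
    then show ?thesis unfolding z_def by (rule addchar_cong)
  qed
  have zjh: "z (n + j * h) = z n" for n j
  proof (induction j)
    case (Suc j)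
    then show ?case using zh[of "n + j * h"] by (simp add: add_ac)
  qed simp
  have fjh: "f (n + j * h) = f n * z n ^ j" for n j
  proof (induction j)
    case (Suc j)
    then show ?case using fh[of "n + j * h"] zjh[of n j] by (simp add: add_ac mult_ac)
  qed simp
  have zsum: "(\<Sum>j<p. z n ^ j) = 0" for n
  proof -
    have "\<not> int p dvd a * int b ^ n * int u"
    proof -
      have "coprime (int p) a"
        using a coprime_divisors[of "int p" "int m" a a] ph(2) by (simp add: coprime_commute)
      moreover have "coprime (int p) (int b ^ n)"
        using cop[OF ph(1)] by simp
      ultimately have "coprime (int p) (a * int b ^ n)" by simp
      then show ?thesis using pu by (simp add: coprime_dvd_mult_right_iff)
    qed
    then show ?thesis
      using sum_addchar[OF p(2), of "a * int b ^ n * int u"] by (simp add: z_def addchar_power)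
  qed
  \<comment> \<open>Each of the \<open>p\<close> shifts by \<open>j * h\<close> leaves the sum over
    a period unchanged.\<close>
  have "of_nat p * (\<Sum>n<T. f n) = (\<Sum>j<p. \<Sum>n<T. f (n + j * h))"
    by (simp add: sum_periodic_shift[of f T, OF per])
  also have "\<dots> = (\<Sum>n<T. \<Sum>j<p. f n * z n ^ j)"
    unfolding fjh by (rule sum.swap)
  also have "\<dots> = 0" by (simp add: sum_distrib_left[symmetric] zsum)
  finally show ?thesis using p by (simp add: f_def T_def)
qed

lemma norm_expsum_le_length: "norm (expsum a m N) \<le> real N"
  unfolding expsum_def using sum_norm_le[of "{1..N}" "\<lambda>n. addchar m (a * int b ^ n)" "\<lambda>_. 1"] by simp

text \<open>Each summand of the bound serves one case. If \<open>m\<close> divides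
  \<open>M_P b P\<close>, then \<open>sqrt m \<le> M_P b P\<close> and the second summand is at
  least \<open>N\<close>. Otherwise the complete sum vanishes and completion with
  \<open>K = sqrt m\<close> gives the first, the period being at most \<open>m\<close>.\<close>

lemma norm_expsum_base:
  assumes m: "m \<in> N_P P" and a: "coprime a (int m)"
  shows "norm (expsum a m N) \<le> (real m powr (1/2) + M_P b P * real m powr (-(1/2)) * real N) * (1 + ln (real m))"
proof -
  have mp: "m > 0" using m by (rule N_P_pos)
  have ln0: "ln (real m) \<ge> 0" using mp by simp
  show ?thesis
  proof (cases "m dvd M_P b P")
    case True
    then have "real m \<le> M_P b P" using M_pos by (simp add: dvd_imp_le)
    moreover have "real m powr (1/2) \<le> real m powr 1" using mp by (intro powr_mono) auto
    ultimately have "1 \<le> M_P b P * real m powr (-(1/2))"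
      using mp by (simp add: powr_minus field_simps)
    then have "real N \<le> M_P b P * real m powr (-(1/2)) * real N"
      using mult_right_mono[of 1 _ "real N"] by simp
    also have "\<dots> \<le> real m powr (1/2) + M_P b P * real m powr (-(1/2)) * real N" by simp
    also have "\<dots> \<le> \<dots> * (1 + ln (real m))"
      using ln0 by (simp add: mult_le_cancel_left1 algebra_simps)
    finally show ?thesis using norm_expsum_le_length[of a m N] by linarith
  next
    case False
    define T where "T = ord m b"
    have mb: "coprime m b" using coprime_N_P m by blast
    have T: "T > 0" using mb by (simp add: T_def)
    have "T \<le> m"
      using dvd_imp_le[OF order_divides_totient[OF mb]] mp totient_le[of m] by (simp add: T_def)
    have bT: "[int b ^ T = 1] (mod int m)"
      using ord[of b m] unfolding T_def by (metis cong_int_iff of_nat_1 of_nat_power)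
    have "norm (expsum a m N) \<le> sqrt (real m) * (1 + ln (real T))"
      unfolding expsum_def
    proof (rule norm_incomplete_sum_le[OF T])
      show "addchar m (a * int b ^ (n + T)) = addchar m (a * int b ^ n)" for n
      proof -
        have "[a * int b ^ n * int b ^ T = a * int b ^ n * 1] (mod int m)"
          by (intro cong_mult cong_refl bT)
        then show ?thesis by (intro addchar_cong) (simp add: power_add mult_ac)
      qed
      show "(\<Sum>n<T. addchar m (a * int b ^ n)) = 0"
        unfolding T_def by (rule complete_sum_eq_0[OF m False a])
    qed (unfold T_def, rule norm_complete_sum_le[OF mp mb a])
    also have "\<dots> \<le> sqrt (real m) * (1 + ln (real m))"
      using \<open>T \<le> m\<close> T by (intro mult_left_mono) auto
    also have "\<dots> \<le> (real m powr (1/2) + M_P b P * real m powr (-(1/2)) * real N) * (1 + ln (real m))"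
      using ln0 by (intro mult_right_mono) (auto simp: powr_half_sqrt)
    finally show ?thesis .
  qed
qed

end

section \<open>Van der Corput's inequality\<close>

lemma norm_sum_squared_le:
  fixes g :: "'a \<Rightarrow> complex"
  shows "(norm (\<Sum>k\<in>K. g k))\<^sup>2 \<le> real (card K) * (\<Sum>k\<in>K. (norm (g k))\<^sup>2)"
proof -
  have "(norm (\<Sum>k\<in>K. g k))\<^sup>2 \<le> (\<Sum>k\<in>K. 1 * norm (g k))\<^sup>2"
    by (intro power_mono) (simp_all add: norm_sum)
  also have "\<dots> \<le> (\<Sum>k\<in>K. 1\<^sup>2) * (\<Sum>k\<in>K. (norm (g k))\<^sup>2)"
    by (rule Cauchy_Schwarz_ineq_sum)
  finally show ?thesis by simp
qed

text \<open>The expression \<open>(i - j) + (j - i)\<close> with truncated subtraction is the distance of the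
  shift indices \<open>i\<close> and \<open>j\<close>.\<close>

lemma van_der_corput:
  fixes f :: "nat \<Rightarrow> complex" and N T J :: nat
  defines "R h \<equiv> norm (\<Sum>n=1..N - h * T. f (n + h * T) * cnj (f n))"
  shows "(real J * norm (\<Sum>n=1..N. f n))\<^sup>2
    \<le> real (N + (J - 1) * T) * (\<Sum>i<J. \<Sum>j<J. R ((i - j) + (j - i)))"
proof -
  define W where "W = N + (J - 1) * T"
  \<comment> \<open>Copies of \<open>f\<close>, cut off to \<open>{1..N}\<close> and translated by
    \<open>i * T\<close>; for \<open>i < J\<close> they are all supported in \<open>{1..W}\<close>
    and have the same sum.\<close>
  define G where "G i k = (if i * T < k \<and> k \<le> i * T + N then f (k - i * T) else 0)" for i k
  have iT: "i * T + N \<le> W" if "i < J" for i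
    using mult_le_mono1[of i "J - 1" T] that by (simp add: W_def Suc_leI le_diff_conv2)
  have sumG: "(\<Sum>k=1..W. G i k) = (\<Sum>n=1..N. f n)" if "i < J" for i
  proof -
    have "(\<Sum>k=1..W. G i k) = (\<Sum>k\<in>{i * T<..i * T + N}. f (k - i * T))"
      by (rule sum.mono_neutral_cong_right) (use iT[OF that] in \<open>auto simp: G_def\<close>)
    also have "\<dots> = (\<Sum>n=1..N. f n)"
      by (rule sum.reindex_bij_witness[of _ "\<lambda>n. n + i * T" "\<lambda>k. k - i * T"]) auto
    finally show ?thesis .
  qed
  have upper: "norm (\<Sum>k=1..W. G i k * cnj (G j k)) = R (j - i)" if "i \<le> j" "i < J" "j < J" for i j
  proof -
    define h where "h = j - i"
    have j: "j * T = i * T + h * T" using that by (simp add: h_def add_mult_distrib[symmetric])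
    have "(\<Sum>k=1..W. G i k * cnj (G j k)) = (\<Sum>k\<in>{j * T<..i * T + N}. f (k - i * T) * cnj (f (k - j * T)))"
      by (rule sum.mono_neutral_cong_right) (use iT[OF that(2)] in \<open>auto simp: G_def j\<close>)
    also have "\<dots> = (\<Sum>n=1..N - h * T. f (n + h * T) * cnj (f n))"
      by (rule sum.reindex_bij_witness[of _ "\<lambda>n. n + j * T" "\<lambda>k. k - j * T"]) (auto simp: j)
    finally show ?thesis by (simp add: R_def h_def)
  qed
  have GR: "norm (\<Sum>k=1..W. G i k * cnj (G j k)) = R ((i - j) + (j - i))" if "i < J" "j < J" for i j
  proof (cases "i \<le> j")
    case False
    have "norm (\<Sum>k=1..W. G i k * cnj (G j k)) = norm (cnj (\<Sum>k=1..W. G i k * cnj (G j k)))"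
      by (rule complex_mod_cnj[symmetric])
    also have "cnj (\<Sum>k=1..W. G i k * cnj (G j k)) = (\<Sum>k=1..W. G j k * cnj (G i k))"
      by (simp add: mult.commute)
    finally show ?thesis using upper[of j i] that False by simp
  qed (use upper that in simp)
  have "of_nat J * (\<Sum>n=1..N. f n) = (\<Sum>i<J. \<Sum>k=1..W. G i k)"
    using sumG by (simp del: One_nat_def)
  also have "\<dots> = (\<Sum>k=1..W. \<Sum>i<J. G i k)" by (rule sum.swap)
  finally have JS: "of_nat J * (\<Sum>n=1..N. f n) = (\<Sum>k=1..W. \<Sum>i<J. G i k)" .
  have "complex_of_real (\<Sum>k=1..W. (norm (\<Sum>i<J. G i k))\<^sup>2) = (\<Sum>k=1..W. \<Sum>i<J. \<Sum>j<J. G i k * cnj (G j k))"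
    by (simp only: of_real_sum complex_norm_square cnj_sum sum_product)
  also have "\<dots> = (\<Sum>i<J. \<Sum>k=1..W. \<Sum>j<J. G i k * cnj (G j k))"
    by (rule sum.swap)
  also have "\<dots> = (\<Sum>i<J. \<Sum>j<J. \<Sum>k=1..W. G i k * cnj (G j k))"
    by (intro sum.cong refl sum.swap)
  finally have "norm (complex_of_real (\<Sum>k=1..W. (norm (\<Sum>i<J. G i k))\<^sup>2))
      \<le> (\<Sum>i<J. \<Sum>j<J. R ((i - j) + (j - i)))"
    by (simp only:) (intro sum_norm_le, use GR in auto)
  then have sq: "(\<Sum>k=1..W. (norm (\<Sum>i<J. G i k))\<^sup>2) \<le> (\<Sum>i<J. \<Sum>j<J. R ((i - j) + (j - i)))"
    unfolding norm_of_real by linarith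
  have "(real J * norm (\<Sum>n=1..N. f n))\<^sup>2 = (norm (\<Sum>k=1..W. \<Sum>i<J. G i k))\<^sup>2"
    unfolding JS[symmetric] by (simp add: norm_mult)
  \<comment> \<open>Cauchy-Schwarz over the \<open>W\<close> positions that the translates occupy
    together.\<close>
  also have "\<dots> \<le> real (card {1..W}) * (\<Sum>k=1..W. (norm (\<Sum>i<J. G i k))\<^sup>2)"
    by (rule norm_sum_squared_le)
  also have "\<dots> \<le> real W * (\<Sum>i<J. \<Sum>j<J. R ((i - j) + (j - i)))"
    using sq by (simp add: mult_left_mono)
  finally show ?thesis by (simp add: W_def)
qed

section \<open>Counting and divisor sums\<close>

lemma card_multiples_le:
  fixes t n :: nat
  assumes "t > 0"
  shows "t * card {h \<in> {1..n}. t dvd h} \<le> n"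
proof -
  have "{h \<in> {1..n}. t dvd h} \<subseteq> (\<lambda>k. t * k) ` {1..n div t}"
  proof
    fix h assume "h \<in> {h \<in> {1..n}. t dvd h}"
    then obtain k where "h = t * k" "1 \<le> h" "h \<le> n" by auto
    then have "k \<in> {1..n div t}"
      using assms by (auto simp: less_eq_div_iff_mult_less_eq mult.commute Suc_le_eq)
    then show "h \<in> (\<lambda>k. t * k) ` {1..n div t}" using \<open>h = t * k\<close> by blast
  qed
  then have "card {h \<in> {1..n}. t dvd h} \<le> card ((\<lambda>k. t * k) ` {1..n div t})"
    by (intro card_mono) auto
  also have "\<dots> \<le> n div t" using card_image_le[of "{1..n div t}" "\<lambda>k. t * k"] by simp
  finally have "t * card {h \<in> {1..n}. t dvd h} \<le> t * (n div t)" by (rule mult_le_mono2)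
  then show ?thesis using times_div_less_eq_dividend[of t n] by linarith
qed

text \<open>The condition forces \<open>t = e / gcd e w\<close> to divide the distance. Distances to
  the left of \<open>i\<close> lie in \<open>{1..i}\<close>, those to the right in
  \<open>{1..J - 1 - i}\<close>; with distance 0 excluded, each side has at most its length over
  \<open>t\<close>. Finally \<open>gcd e w \<le> w\<close>.\<close>

lemma card_distance_multiples_le:
  fixes e w i J :: nat
  assumes e: "e > 0" and w: "w > 0" and i: "i < J"
  shows "e * card {j \<in> {..<J} - {i}. e dvd w * ((i - j) + (j - i))} \<le> w * J"
proof -
  define g where "g = gcd e w"
  define t where "t = e div g"
  have et: "e = t * g" by (simp add: t_def g_def)
  have t0: "t > 0" using e et by (cases t) auto
  have g0: "g > 0" and gw: "g \<le> w" using w by (auto simp: g_def intro: gcd_le2_nat)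
  have tdvd: "t dvd h" if "e dvd w * h" for h
  proof -
    have "coprime t (w div g)" unfolding t_def g_def using e by (intro div_gcd_coprime) auto
    moreover have "t * g dvd g * (w div g) * h" using that unfolding et by (simp add: g_def)
    then have "t dvd (w div g) * h" using g0 by (simp add: mult.commute mult.left_commute)
    ultimately show ?thesis by (simp add: coprime_dvd_mult_right_iff)
  qed
  let ?A = "{h \<in> {1..i}. t dvd h}" and ?B = "{h \<in> {1..J - 1 - i}. t dvd h}"
  have "{j \<in> {..<J} - {i}. e dvd w * ((i - j) + (j - i))} \<subseteq> (\<lambda>h. i - h) ` ?A \<union> (\<lambda>h. i + h) ` ?B"
  proof
    fix j assume j: "j \<in> {j \<in> {..<J} - {i}. e dvd w * ((i - j) + (j - i))}"
    then have td: "t dvd (i - j) + (j - i)" using tdvd by blast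
    show "j \<in> (\<lambda>h. i - h) ` ?A \<union> (\<lambda>h. i + h) ` ?B"
    proof (cases "j < i")
      case True
      then have "i - j \<in> ?A" "j = i - (i - j)" using td by auto
      then show ?thesis by blast
    next
      case False
      then have "j - i \<in> ?B" "j = i + (j - i)" using td j by auto
      then show ?thesis by blast
    qed
  qed
  then have "card {j \<in> {..<J} - {i}. e dvd w * ((i - j) + (j - i))} \<le> card ((\<lambda>h. i - h) ` ?A \<union> (\<lambda>h. i + h) ` ?B)"
    by (intro card_mono) auto
  also have "\<dots> \<le> card ((\<lambda>h. i - h) ` ?A) + card ((\<lambda>h. i + h) ` ?B)" by (rule card_Un_le)
  also have "\<dots> \<le> card ?A + card ?B" by (intro add_mono card_image_le) auto
  finally have "t * card {j \<in> {..<J} - {i}. e dvd w * ((i - j) + (j - i))} \<le> t * (card ?A + card ?B)"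
    by (rule mult_le_mono2)
  also have "\<dots> \<le> i + (J - 1 - i)"
    using card_multiples_le[OF t0, of i] card_multiples_le[OF t0, of "J - 1 - i"]
    by (simp only: distrib_left)
  also have "\<dots> \<le> J" using i by simp
  finally have "g * (t * card {j \<in> {..<J} - {i}. e dvd w * ((i - j) + (j - i))}) \<le> w * J"
    using gw by (intro mult_le_mono)
  then show ?thesis unfolding et by (simp only: mult_ac)
qed

section \<open>Euler products\<close>

lemma euler_factor_pos:
  fixes x :: real
  assumes "prime p" "x > 0"
  shows "real p powr x > 1"
  using assms prime_gt_1_nat[of p] by (intro gr_one_powr) auto

lemma C_P_ge_1:
  assumes "\<And>p. p \<in> P \<Longrightarrow> prime p" "x > 0"
  shows "C_P P x \<ge> 1"
  unfolding C_P_def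
proof (rule prod_ge_1)
  fix p assume "p \<in> P"
  then show "1 \<le> real p powr x / (real p powr x - 1)"
    using euler_factor_pos[of p x] assms by (simp add: field_simps)
qed

lemma geometric_sum_le:
  fixes p :: nat and x :: real
  assumes "prime p" "x > 0"
  shows "(\<Sum>k\<le>K. real (p ^ k) powr (- x)) \<le> real p powr x / (real p powr x - 1)"
proof -
  define r where "r = real p powr (- x)"
  have px: "real p powr x > 1" using assms by (rule euler_factor_pos)
  have r: "0 < r" "r < 1" "r = 1 / real p powr x"
    using px prime_gt_0_nat[OF assms(1)] by (auto simp: r_def powr_minus field_simps)
  have "real (p ^ k) powr (- x) = r ^ k" for k
    using assms(1) prime_gt_0_nat[of p]
    by (simp add: r_def powr_realpow[symmetric] powr_powr powr_power mult.commute)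
  then have "(\<Sum>k\<le>K. real (p ^ k) powr (- x)) = (\<Sum>k<Suc K. r ^ k)"
    by (simp add: lessThan_Suc_atMost)
  also have "\<dots> < 1 / (1 - r)" using r by (intro geometric_sum_less) auto
  also have "1 / (1 - r) = real p powr x / (real p powr x - 1)"
    using px prime_gt_0_nat[OF assms(1)] by (simp add: r(3) field_simps)
  finally show ?thesis by simp
qed

text \<open>Induction on \<open>P\<close>, splitting off the exact power of the new prime
  \<open>p\<close>. The map sending \<open>d\<close> to its exponent and cofactor is injective, so
  the sum is at most a product of a geometric sum and a sum for the smaller set of primes.\<close>

lemma sum_N_P_le_C_P:
  assumes "finite P" "\<And>p. p \<in> P \<Longrightarrow> prime p" "x > 0" "finite D" "D \<subseteq> N_P P"
  shows "(\<Sum>d\<in>D. real d powr (- x)) \<le> C_P P x"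
  using assms(1,2,4,5)
proof (induction P arbitrary: D rule: finite_induct)
  case empty
  have "d = 1" if "d \<in> N_P {}" for d
    using that prime_factor_nat[of d] by (auto simp: N_P_def)
  then have "D \<subseteq> {1}" using empty by blast
  then have "(\<Sum>d\<in>D. real d powr (- x)) \<le> (\<Sum>d\<in>{1}. real d powr (- x))"
    by (intro sum_mono2) auto
  then show ?case by (simp add: C_P_def)
next
  case (insert p P)
  have p: "prime p" "p > 0" using insert.prems prime_gt_0_nat by auto
  define v where "v d = multiplicity p d" for d
  define c where "c d = d div p ^ v d" for d
  have dec: "d = p ^ v d * c d" for d
    by (simp add: c_def v_def multiplicity_dvd)
  have cN: "c d \<in> N_P P" if "d \<in> D" for d
  proof -
    have d: "d > 0" "\<And>q. prime q \<Longrightarrow> q dvd d \<Longrightarrow> q \<in> insert p P"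
      using that insert.prems(3) by (auto simp: N_P_def)
    have "c d > 0" using d(1) dec[of d] by (metis gr0I mult_0_right less_irrefl)
    moreover have "\<not> p dvd c d"
      unfolding c_def v_def using d(1) p not_prime_unit[of p] by (intro multiplicity_decompose) auto
    moreover have "c d dvd d" using dec[of d] by (metis dvd_triv_right)
    ultimately show ?thesis unfolding N_P_def using d(2) dvd_trans by blast
  qed
  \<comment> \<open>Inserting 0 keeps the maximum defined when \<open>D\<close> is empty.\<close>
  define K where "K = Max (insert 0 (v ` D))"
  have vK: "v d \<le> K" if "d \<in> D" for d unfolding K_def using insert.prems that by (intro Max_ge) auto
  have inj: "inj_on (\<lambda>d. (v d, c d)) D"
    by (rule inj_onI) (metis dec prod.inject)
  have "(\<Sum>d\<in>D. real d powr (- x)) = (\<Sum>d\<in>D. real (p ^ v d) powr (- x) * real (c d) powr (- x))"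
    by (rule sum.cong[OF refl], subst dec) (simp add: powr_mult)
  also have "\<dots> = (\<Sum>(k, e)\<in>(\<lambda>d. (v d, c d)) ` D. real (p ^ k) powr (- x) * real e powr (- x))"
    by (simp add: sum.reindex[OF inj])
  also have "\<dots> \<le> (\<Sum>(k, e)\<in>{..K} \<times> c ` D. real (p ^ k) powr (- x) * real e powr (- x))"
    using insert.prems(2) vK by (intro sum_mono2) auto
  also have "\<dots> = (\<Sum>k\<le>K. real (p ^ k) powr (- x)) * (\<Sum>e\<in>c ` D. real e powr (- x))"
    by (simp add: sum_product sum.cartesian_product)
  also have "\<dots> \<le> (real p powr x / (real p powr x - 1)) * C_P P x"
  proof (intro mult_mono)
    show "(\<Sum>k\<le>K. real (p ^ k) powr (- x)) \<le> real p powr x / (real p powr x - 1)"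
      by (rule geometric_sum_le[OF p(1) assms(3)])
    show "(\<Sum>e\<in>c ` D. real e powr (- x)) \<le> C_P P x"
      using insert.prems cN by (intro insert.IH) auto
    show "0 \<le> real p powr x / (real p powr x - 1)"
      using euler_factor_pos[OF p(1) assms(3)] by simp
  qed (intro sum_nonneg, simp)
  also have "\<dots> = C_P (insert p P) x" using insert.hyps by (simp add: C_P_def)
  finally show ?case .
qed

section \<open>The differencing inequality\<close>

context prime_base
begin

text \<open>Take the largest divisor of \<open>m\<close> not exceeding \<open>y\<close>. It is not
  \<open>m\<close> itself, so multiplying by some prime of \<open>P\<close> gives another divisor,
  which exceeds \<open>y\<close>; that prime is at most \<open>Q_P P\<close>.\<close>

lemma exists_divisor_near:
  assumes m: "m \<in> N_P P" and y: "1 \<le> y" "y < real m"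
  obtains d where "d dvd m" "real d \<le> y" "y < real (Q_P P) * real d"
proof -
  have mp: "m > 0" using m by (rule N_P_pos)
  define A where "A = {d. d dvd m \<and> real d \<le> y}"
  have fin: "finite A" using mp by (simp add: A_def finite_divisors_nat)
  have "1 \<in> A" using y by (simp add: A_def)
  define d where "d = Max A"
  have "d \<in> A" unfolding d_def using fin \<open>1 \<in> A\<close> by (intro Max_in) auto
  then have d: "d dvd m" "real d \<le> y" by (auto simp: A_def)
  then obtain c where c: "m = d * c" by auto
  have "c \<noteq> 1" using c d(2) y(2) by auto
  then obtain p where p: "prime p" "p dvd c" using prime_factor_nat by blast
  have dp: "d * p dvd m" using p c by simp
  then have "p \<in> P" using m p by (auto simp: N_P_def dest: dvd_mult_right)
  have d0: "d > 0" using c mp by (cases d) auto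
  have "d * p \<notin> A"
  proof
    assume "d * p \<in> A"
    then have "d * p \<le> d" unfolding d_def using fin by (intro Max_ge)
    then show False using d0 prime_gt_1_nat[OF p(1)] by simp
  qed
  then have "y < real (d * p)" using dp by (simp add: A_def)
  also have "\<dots> \<le> real (Q_P P) * real d"
    using prime_le_Q[OF \<open>p \<in> P\<close>] by (simp add: mult.commute mult_left_mono)
  finally show ?thesis using that d by blast
qed

text \<open>Group by the value \<open>y\<close> of \<open>e\<close>: it occurs at most
  \<open>w * J / y\<close> times and contributes \<open>y powr \<alpha>\<close> each time. The
  remaining sum of \<open>y powr - (1 - \<alpha>)\<close> is bounded by an Euler product, as
  \<open>\<alpha> < 1\<close>.\<close>

lemma sum_distance_powr_le:
  fixes e :: "nat \<Rightarrow> nat"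
  assumes \<alpha>: "\<alpha> < 1" and D: "finite D" "D \<subseteq> N_P P" and w: "w > 0" and i: "i < J"
    and e: "\<And>h. h > 0 \<Longrightarrow> e h \<in> D" "\<And>h. h > 0 \<Longrightarrow> e h dvd w * h"
  shows "(\<Sum>j\<in>{..<J} - {i}. real (e ((i - j) + (j - i))) powr \<alpha>) \<le> real w * real J * C_P P (1 - \<alpha>)"
proof -
  define A where "A = {..<J} - {i}"
  define g where "g j = e ((i - j) + (j - i))" for j
  have g: "g j \<in> D" "g j dvd w * ((i - j) + (j - i))" if "j \<in> A" for j
  proof -
    have "(i - j) + (j - i) > 0" using that by (cases "j < i") (auto simp: A_def)
    then show "g j \<in> D" "g j dvd w * ((i - j) + (j - i))" unfolding g_def by (fact e)+
  qed
  have "(\<Sum>j\<in>A. real (g j) powr \<alpha>) = (\<Sum>y\<in>D. \<Sum>j\<in>{j \<in> A. g j = y}. real (g j) powr \<alpha>)"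
    using D(1) g(1) by (intro sum.group[symmetric]) (auto simp: A_def)
  also have "\<dots> \<le> (\<Sum>y\<in>D. real w * real J * real y powr (- (1 - \<alpha>)))"
  proof (rule sum_mono)
    fix y assume "y \<in> D"
    then have y: "y > 0" using D(2) N_P_pos by blast
    let ?B = "{j \<in> {..<J} - {i}. y dvd w * ((i - j) + (j - i))}"
    have "card {j \<in> A. g j = y} \<le> card ?B"
      using g(2) by (intro card_mono) (auto simp: A_def)
    then have "y * card {j \<in> A. g j = y} \<le> w * J"
      using card_distance_multiples_le[OF y w i] mult_le_mono2 order_trans by blast
    then have "real (y * card {j \<in> A. g j = y}) \<le> real (w * J)" by (simp only: of_nat_le_iff)
    then have "real (card {j \<in> A. g j = y}) \<le> real w * real J / real y"
      using y by (simp add: field_simps)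
    have "(\<Sum>j\<in>{j \<in> A. g j = y}. real (g j) powr \<alpha>) = real (card {j \<in> A. g j = y}) * real y powr \<alpha>"
      by simp
    also have "\<dots> \<le> (real w * real J / real y) * real y powr \<alpha>"
      by (intro mult_right_mono) (fact, simp)
    also have "\<dots> = real w * real J * real y powr (- (1 - \<alpha>))"
      using y by (simp add: powr_diff)
    finally show "(\<Sum>j\<in>{j \<in> A. g j = y}. real (g j) powr \<alpha>) \<le> real w * real J * real y powr (- (1 - \<alpha>))" .
  qed
  also have "\<dots> = real w * real J * (\<Sum>y\<in>D. real y powr (- (1 - \<alpha>)))"
    by (rule sum_distrib_left[symmetric])
  also have "\<dots> \<le> real w * real J * C_P P (1 - \<alpha>)"
    using \<alpha> D fin prm by (intro mult_left_mono sum_N_P_le_C_P) auto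
  finally show ?thesis by (simp add: A_def g_def)
qed

text \<open>The phase difference is a multiple of \<open>(b ^ h - 1) / m\<close>. Reducing this
  fraction by \<open>G\<close> leaves a numerator prime to the new modulus, so correlations stay
  within the same family of sums.\<close>

lemma correlation_eq:
  fixes h K :: nat
  assumes m: "m \<in> N_P P" and a: "coprime a (int m)"
  defines "G \<equiv> gcd (b ^ h - 1) m"
  obtains a' where "coprime a' (int (m div G))"
    "(\<Sum>n=1..K. addchar m (a * int b ^ (n + h)) * cnj (addchar m (a * int b ^ n))) = expsum a' (m div G) K"
proof -
  have mp: "m > 0" using m by (rule N_P_pos)
  have G: "G > 0" "G dvd m" "G dvd b ^ h - 1" using mp by (auto simp: G_def)
  define c where "c = (b ^ h - 1) div G"
  have cG: "b ^ h - 1 = G * c" using G by (simp add: c_def)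
  have mG: "m = G * (m div G)" using G by simp
  have "coprime c (m div G)" unfolding c_def G_def using mp by (intro div_gcd_coprime) auto
  then have "coprime (int c) (int (m div G))" by simp
  moreover have "coprime a (int (m div G))"
  proof (rule coprime_divisors[of a a "int (m div G)" "int m"])
    show "int (m div G) dvd int m" using G by (metis mG dvd_triv_right int_dvd_int_iff)
  qed (use a in auto)
  ultimately have "coprime (a * int c) (int (m div G))" by simp
  moreover have "(\<Sum>n=1..K. addchar m (a * int b ^ (n + h)) * cnj (addchar m (a * int b ^ n)))
      = expsum (a * int c) (m div G) K"
    unfolding expsum_def
  proof (intro sum.cong refl)
    fix n
    have "int b ^ h = 1 + int G * int c" using int_power_minus_one[of h] unfolding cG by simp
    then have "a * int b ^ (n + h) - a * int b ^ n = int G * (a * int c * int b ^ n)"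
      by (simp add: power_add algebra_simps)
    then have "addchar m (a * int b ^ (n + h)) * cnj (addchar m (a * int b ^ n))
        = addchar m (int G * (a * int c * int b ^ n))"
      by (simp only: addchar_diff[symmetric])
    also have "\<dots> = addchar (G * (m div G)) (int G * (a * int c * int b ^ n))"
      using mG by simp
    also have "\<dots> = addchar (m div G) (a * int c * int b ^ n)"
      using G(1) by (rule addchar_scale)
    finally show "addchar m (a * int b ^ (n + h)) * cnj (addchar m (a * int b ^ n))
        = addchar (m div G) (a * int c * int b ^ n)" .
  qed
  ultimately show ?thesis by (rule that)
qed

text \<open>The three terms come from the diagonal correlations and from the two summands of the
  hypothesis applied to the off-diagonal ones. Only the last depends on the gcds, and it is averaged
  over the shifts.\<close>

lemma norm_expsum_differencing:
  fixes A B \<alpha> \<gamma> \<nu> L y :: real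
  assumes m: "m \<in> N_P P" and a: "coprime a (int m)"
    and d: "d dvd m" "real d \<le> y" "y < real (Q_P P) * real d"
    and N: "ord d b \<le> N"
    and par: "0 < \<alpha>" "\<alpha> < 1" "A \<ge> 0" "B \<ge> 0" "\<gamma> \<ge> 0" "\<nu> \<ge> 0" "L \<ge> 0"
    and IH: "\<And>m' a' N'. m' dvd m \<Longrightarrow> coprime a' (int m') \<Longrightarrow>
      norm (expsum a' m' N') \<le> (A * real m' powr \<alpha> * real N' powr \<gamma> + B * real m' powr (- \<alpha>) * real N' powr \<nu>) * L"
  shows "(norm (expsum a m N))\<^sup>2 \<le> 4 * real N * y
    + 2 * A * real (Q_P P) powr \<alpha> * (real N powr (1 + \<gamma>) * real m powr \<alpha> * y powr (- \<alpha>)) * L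
    + 2 * B * M_P b P * C_P P (1 - \<alpha>) * (real N powr (1 + \<nu>) * real m powr (- \<alpha>) * y powr \<alpha>) * L"
proof -
  have mp: "m > 0" using m by (rule N_P_pos)
  have dP: "d \<in> N_P P" using N_P_dvd[OF m d(1)] .
  have dp: "d > 0" using dP by (rule N_P_pos)
  have db: "coprime d b" using coprime_N_P[OF dP] .
  define T where "T = ord d b"
  have Tp: "T > 0" using db by (simp add: T_def)
  have Td: "T \<le> d"
    using dvd_imp_le[OF order_divides_totient[OF db]] dp totient_le[of d] by (simp add: T_def)
  have TN: "T \<le> N" using N by (simp add: T_def)
  have Np: "N > 0" using TN Tp by simp
  have yp: "y > 0" using d(2) dp by linarith
  \<comment> \<open>As many shifts as fit into \<open>N\<close>: then
    \<open>N + (J - 1) * T \<le> 2 * N\<close>, and \<open>N < (J + 1) * T \<le> 2 * J * T\<close>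
    gives \<open>N / J \<le> 2 * T \<le> 2 * y\<close>.\<close>
  define J where "J = N div T"
  have Jp: "J > 0" using TN Tp by (simp add: J_def div_greater_zero_iff)
  have dbT: "d dvd b ^ (h * T) - 1" for h
  proof -
    have "[b ^ T = 1] (mod d)" unfolding T_def by (rule ord)
    from cong_pow[OF this, of h] have "[b ^ (h * T) = 1] (mod d)"
      by (simp add: power_mult[symmetric] mult.commute)
    then show ?thesis using cong_to_1_nat by blast
  qed
  have "d dvd M_P b P * T"
    using N_P_dvd_power_minus_one[OF dP Tp] dbT[of 1] by simp
  \<comment> \<open>The cofactor \<open>w\<close> accounts for the step \<open>T\<close>:
    \<open>G h\<close> divides \<open>M_P b P * T * h = d * w * h\<close>, hence \<open>e h\<close>
    divides \<open>w * h\<close>; and \<open>T \<le> d\<close> gives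
    \<open>w \<le> M_P b P\<close>.\<close>
  then obtain w where w: "M_P b P * T = d * w" by auto
  have wp: "w > 0" using w M_pos Tp by (cases w) auto
  have "d * w \<le> d * M_P b P" using Td unfolding w[symmetric] by simp
  then have wM: "w \<le> M_P b P" using dp by simp
  define G where "G h = gcd (b ^ (h * T) - 1) m" for h
  define e where "e h = G h div d" for h
  have Gd: "G h = d * e h" for h
    using dbT[of h] d(1) by (simp add: e_def G_def)
  have Gm: "G h dvd m" for h by (simp add: G_def)
  have Gp: "G h > 0" for h using Gm[of h] mp by (rule dvd_pos_nat[rotated])
  have ep: "e h > 0" for h using Gp[of h] Gd[of h] by (cases "e h") auto
  have ew: "e h dvd w * h" if "h > 0" for h
  proof -
    have "G h dvd b ^ (h * T) - 1" by (simp add: G_def)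
    then have "G h dvd M_P b P * (h * T)"
      using that Tp N_P_dvd[OF m Gm] by (intro N_P_dvd_power_minus_one) auto
    also have "M_P b P * (h * T) = (M_P b P * T) * h" by (simp add: mult_ac)
    also have "\<dots> = d * (w * h)" unfolding w by (simp add: mult_ac)
    finally show ?thesis using dp by (simp add: Gd)
  qed
  have em: "e h dvd m" for h using Gm[of h] unfolding Gd by (rule dvd_mult_right)
  define f where "f n = addchar m (a * int b ^ n)" for n
  define R where "R h = norm (\<Sum>n=1..N - h * T. f (n + h * T) * cnj (f n))" for h
  define P1 where "P1 = A * real (Q_P P) powr \<alpha> * (real N powr \<gamma> * real m powr \<alpha> * y powr (- \<alpha>)) * L"
  define P2 where "P2 = B * (real N powr \<nu> * real m powr (- \<alpha>) * y powr \<alpha>) * L"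
  have P1: "P1 \<ge> 0" and P2: "P2 \<ge> 0" using par by (auto simp: P1_def P2_def)
  have R0: "R 0 \<le> real N"
    unfolding R_def using sum_norm_le[of "{1..N}" "\<lambda>n. f n * cnj (f n)" "\<lambda>_. 1"]
    by (simp add: norm_mult f_def)
  have Rh: "R h \<le> P1 + P2 * real (e h) powr \<alpha>" for h
  proof -
    obtain a' where a': "coprime a' (int (m div G h))"
      "(\<Sum>n=1..N - h * T. addchar m (a * int b ^ (n + h * T)) * cnj (addchar m (a * int b ^ n)))
        = expsum a' (m div G h) (N - h * T)"
      unfolding G_def by (rule correlation_eq[OF m a])
    define m' where "m' = m div G h"
    have m'm: "m = G h * m'" using Gm by (simp add: m'_def)
    have m'p: "m' > 0" using mp m'm by (cases m') auto
    have m'eq: "real m' = real m / (real d * real (e h))"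
      using m'm Gp[of h] dp ep[of h] unfolding Gd by (simp add: field_simps)
    have "R h = norm (expsum a' m' (N - h * T))" using a'(2) by (simp add: R_def f_def m'_def)
    also have "\<dots> \<le> (A * real m' powr \<alpha> * real (N - h * T) powr \<gamma>
        + B * real m' powr (- \<alpha>) * real (N - h * T) powr \<nu>) * L"
      using a'(1) m'm unfolding m'_def[symmetric] by (intro IH) (metis dvd_triv_right)
    also have "\<dots> \<le> (A * (real (Q_P P) powr \<alpha> * real m powr \<alpha> * y powr (- \<alpha>)) * real N powr \<gamma>
        + B * (real m powr (- \<alpha>) * y powr \<alpha> * real (e h) powr \<alpha>) * real N powr \<nu>) * L"
    proof (intro mult_right_mono add_mono mult_mono mult_left_mono)
      \<comment> \<open>In the positive power of \<open>m'\<close> the factor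
        \<open>e h \<ge> 1\<close> is dropped and \<open>y < Q_P P * d\<close> is used; in the
        negative power \<open>e h\<close> is kept and \<open>d \<le> y\<close> is used.\<close>
      have "real m' \<le> real m / real d"
        unfolding m'eq using dp ep[of h] by (intro divide_left_mono) auto
      also have "\<dots> \<le> real (Q_P P) * real m / y"
        using d(3) dp yp mp by (simp add: field_simps)
      finally have "real m' powr \<alpha> \<le> (real (Q_P P) * real m / y) powr \<alpha>"
        using par by (intro powr_mono2) auto
      then show "real m' powr \<alpha> \<le> real (Q_P P) powr \<alpha> * real m powr \<alpha> * y powr (- \<alpha>)"
        using yp by (simp add: powr_mult powr_divide powr_minus_divide)
      have "real m' powr (- \<alpha>) = real m powr (- \<alpha>) * (real d powr \<alpha> * real (e h) powr \<alpha>)"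
        using dp mp ep[of h] by (simp add: m'eq powr_mult powr_divide powr_minus field_simps)
      also have "\<dots> \<le> real m powr (- \<alpha>) * (y powr \<alpha> * real (e h) powr \<alpha>)"
        using d(2) par by (intro mult_left_mono mult_right_mono powr_mono2) auto
      finally show "real m' powr (- \<alpha>) \<le> real m powr (- \<alpha>) * y powr \<alpha> * real (e h) powr \<alpha>"
        by (simp add: mult_ac)
    qed (use par in \<open>auto intro!: powr_mono2\<close>)
    also have "\<dots> = P1 + P2 * real (e h) powr \<alpha>"
      by (simp add: P1_def P2_def algebra_simps)
    finally show ?thesis .
  qed
  define C where "C = C_P P (1 - \<alpha>)"
  have C: "C \<ge> 1" unfolding C_def using par prm by (intro C_P_ge_1) auto
  have inner: "(\<Sum>j<J. R ((i - j) + (j - i))) \<le> real N + real J * P1 + P2 * (real (M_P b P) * real J * C)"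
    if i: "i < J" for i
  proof -
    \<comment> \<open>The divisibility \<open>e h dvd w * h\<close> carries no information at
      distance 0, so the diagonal term is bounded trivially by \<open>N\<close>.\<close>
    have "(\<Sum>j<J. R ((i - j) + (j - i))) = R 0 + (\<Sum>j\<in>{..<J} - {i}. R ((i - j) + (j - i)))"
      using i by (subst sum.remove[of _ i]) auto
    also have "\<dots> \<le> real N + (\<Sum>j\<in>{..<J} - {i}. P1 + P2 * real (e ((i - j) + (j - i))) powr \<alpha>)"
      by (intro add_mono R0 sum_mono Rh)
    also have "\<dots> = real N + real (card ({..<J} - {i})) * P1
        + P2 * (\<Sum>j\<in>{..<J} - {i}. real (e ((i - j) + (j - i))) powr \<alpha>)"
      by (simp add: sum.distrib sum_distrib_left)
    also have "\<dots> \<le> real N + real J * P1 + P2 * (real (M_P b P) * real J * C)"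
    proof (intro add_mono mult_right_mono mult_left_mono order_refl)
      show "real (card ({..<J} - {i})) \<le> real J"
        using card_mono[of "{..<J}" "{..<J} - {i}"] by simp
      have "(\<Sum>j\<in>{..<J} - {i}. real (e ((i - j) + (j - i))) powr \<alpha>) \<le> real w * real J * C"
        unfolding C_def
      proof (rule sum_distance_powr_le[where D = "{x. x dvd m}"])
        show "finite {x. x dvd m}" using mp by (simp add: finite_divisors_nat)
        show "{x. x dvd m} \<subseteq> N_P P" using N_P_dvd[OF m] by blast
      qed (use par wp i em ew in auto)
      also have "\<dots> \<le> real (M_P b P) * real J * C"
        using wM C by (intro mult_right_mono) auto
      finally show "(\<Sum>j\<in>{..<J} - {i}. real (e ((i - j) + (j - i))) powr \<alpha>) \<le> real (M_P b P) * real J * C" .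
    qed (use P1 P2 in auto)
    finally show ?thesis .
  qed
  define Z where "Z = real N + real J * P1 + P2 * (real (M_P b P) * real J * C)"
  have Z0: "Z \<ge> 0" using P1 P2 C by (simp add: Z_def)
  have JT: "J * T \<le> N" by (simp add: J_def)
  have "(real J * norm (expsum a m N))\<^sup>2 \<le> real (N + (J - 1) * T) * (\<Sum>i<J. \<Sum>j<J. R ((i - j) + (j - i)))"
    using van_der_corput[of J f N T] unfolding expsum_def R_def f_def .
  also have "\<dots> \<le> real (2 * N) * (\<Sum>i<J. Z)"
  proof (intro mult_mono sum_mono)
    have "(J - 1) * T \<le> N" using JT by (simp add: diff_mult_distrib)
    then have "N + (J - 1) * T \<le> 2 * N" by simp
    then show "real (N + (J - 1) * T) \<le> real (2 * N)" by (simp only: of_nat_le_iff)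
  qed (use inner in \<open>auto simp: Z_def R_def intro!: sum_nonneg\<close>)
  finally have "(real J)\<^sup>2 * (norm (expsum a m N))\<^sup>2 \<le> (real J)\<^sup>2 * (2 * real N * (Z / real J))"
    using Jp by (simp add: power_mult_distrib power2_eq_square mult_ac)
  then have "(norm (expsum a m N))\<^sup>2 \<le> 2 * real N * (Z / real J)"
    by (rule mult_left_le_imp_le) (use Jp in simp)
  also have "Z / real J = real N / real J + P1 + P2 * real (M_P b P) * C"
    using Jp by (simp add: Z_def field_simps)
  also have "real N / real J \<le> 2 * y"
  proof -
    have "N < (J + 1) * T" using Tp by (simp add: J_def dividend_less_div_times)
    also have "\<dots> \<le> (2 * J) * T" using Jp by (intro mult_le_mono1) auto
    finally have "real N \<le> real (2 * J * T)" by linarith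
    also have "\<dots> \<le> 2 * real J * y" using Td d(2) by (simp add: mult_left_mono)
    finally show ?thesis using Jp by (simp add: field_simps)
  qed
  finally have "(norm (expsum a m N))\<^sup>2 \<le> 2 * real N * (2 * y + P1 + P2 * real (M_P b P) * C)"
    by (simp add: mult_left_mono)
  also have "\<dots> = 4 * real N * y
    + 2 * A * real (Q_P P) powr \<alpha> * (real N powr (1 + \<gamma>) * real m powr \<alpha> * y powr (- \<alpha>)) * L
    + 2 * B * M_P b P * C_P P (1 - \<alpha>) * (real N powr (1 + \<nu>) * real m powr (- \<alpha>) * y powr \<alpha>) * L"
    using Np by (simp add: P1_def P2_def C_def powr_add algebra_simps)
  finally show ?thesis .
qed

end

section \<open>The induction\<close>

lemma alpha_eq: "alpha k = 1 / (4 * 2 ^ k - 2)"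
  by (simp add: alpha_def power_add)

lemma alpha_pos: "alpha k > 0"
  unfolding alpha_eq using one_le_power[of "2::real" k] by (intro divide_pos_pos) linarith+

lemma alpha_le_half: "alpha k \<le> 1 / 2"
  using one_le_power[of "2::real" k] unfolding alpha_eq by (intro frac_le) auto

text \<open>The recursion produced by balancing; for reciprocals it is affine,
  \<open>1 / alpha (Suc k) = 2 / alpha k + 2\<close>, and the closed form solves it.\<close>

lemma alpha_Suc: "alpha (Suc k) = alpha k / (2 * (1 + alpha k))"
proof -
  define t :: real where "t = 2 ^ k"
  have "t \<ge> 1" by (simp add: t_def)
  have eqs: "alpha k = 1 / (4 * t - 2)" "alpha (Suc k) = 1 / (8 * t - 2)"
    by (simp_all add: alpha_eq t_def)
  show ?thesis unfolding eqs using \<open>t \<ge> 1\<close> by (simp add: field_simps)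
qed

text \<open>The last inequality makes the exponent of \<open>N\<close> in the balancing value
  \<open>y\<close> nonnegative, so \<open>y \<ge> 1\<close>. It propagates because the quantity
  obeys an affine recursion with positive coefficients, \<open>alpha k\<close> being below
  1.\<close>

lemma gamma_nu_bounds: "gamma k \<ge> 0 \<and> nu k \<ge> 1 \<and> 1 + gamma k - nu k \<ge> 0"
proof (induction k)
  case (Suc k)
  have a: "0 < alpha k" "alpha k \<le> 1 / 2" by (rule alpha_pos alpha_le_half)+
  have IH: "gamma k \<ge> 0" "nu k \<ge> 1" "1 + gamma k - nu k \<ge> 0" using Suc by auto
  have "gamma (Suc k) \<ge> 0" using IH a by simp
  moreover have "nu (Suc k) \<ge> 1"
  proof -
    define z where "z = (1 + gamma k - nu k) * alpha k / (2 * (1 + alpha k))"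
    have "z \<ge> 0" using IH a by (simp add: z_def)
    moreover have "nu (Suc k) = (1 + nu k) / 2 + z" by (simp add: z_def)
    moreover have "1 + 0 \<le> (1 + nu k) / 2 + z"
      by (intro add_mono) (use IH \<open>z \<ge> 0\<close> in simp_all)
    ultimately show ?thesis by simp
  qed
  moreover have "1 + gamma (Suc k) - nu (Suc k)
      = 1 / 2 + (1 - alpha k) * (1 + gamma k - nu k) / (2 * (1 + alpha k))"
  proof -
    define q where "q = 1 / (2 * (1 + alpha k))"
    have div: "z / (2 * (1 + alpha k)) = z * q" for z by (simp add: q_def)
    have "nu k / 2 = nu k * (1 + alpha k) * q" using a by (simp add: q_def field_simps)
    then show ?thesis unfolding gamma.simps nu.simps div by (simp add: algebra_simps add_divide_distrib)
  qed
  then have "1 + gamma (Suc k) - nu (Suc k) \<ge> 0" using IH a by simp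
  ultimately show ?case by blast
qed simp

section \<open>The inductive step and the constants\<close>

context prime_base
begin

text \<open>All estimates are made for the square of the norm, compared with
  \<open>A'\<^sup>2 * u\<^sup>2 + B'\<^sup>2 * v\<^sup>2\<close>; the final square root halves the
  exponent \<open>\<epsilon>\<close> of the logarithm.\<close>

lemma norm_expsum_step:
  fixes A B A' B' \<alpha> \<gamma> \<nu> \<epsilon> :: real
  assumes m: "m \<in> N_P P" and a: "coprime a (int m)"
    and par: "0 < \<alpha>" "\<alpha> < 1" "A \<ge> 0" "B \<ge> 0" "\<gamma> \<ge> 0" "\<nu> \<ge> 1" "1 + \<gamma> - \<nu> \<ge> 0" "\<epsilon> \<ge> 0"
    and A': "A' \<ge> 1" "A'\<^sup>2 \<ge> 4 + 2 * A * real (Q_P P) powr \<alpha>"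
    and B': "B' \<ge> 1" "B'\<^sup>2 \<ge> 2 * B * M_P b P * C_P P (1 - \<alpha>)"
    and IH: "\<And>m' a' N'. m' \<in> N_P P \<Longrightarrow> coprime a' (int m') \<Longrightarrow>
      norm (expsum a' m' N') \<le> (A * real m' powr \<alpha> * real N' powr \<gamma> + B * real m' powr (- \<alpha>) * real N' powr \<nu>)
        * (1 + ln (real m')) powr \<epsilon>"
  defines "\<alpha>' \<equiv> \<alpha> / (2 * (1 + \<alpha>))" and "\<gamma>' \<equiv> (1 + \<gamma> + \<alpha> * \<nu>) / (2 * (1 + \<alpha>))"
    and "\<nu>' \<equiv> (1 + \<nu>) / 2 + (1 + \<gamma> - \<nu>) * \<alpha> / (2 * (1 + \<alpha>))"
  shows "norm (expsum a m N) \<le> (A' * real m powr \<alpha>' * real N powr \<gamma>' + B' * real m powr (- \<alpha>') * real N powr \<nu>')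
    * (1 + ln (real m)) powr (\<epsilon> / 2)"
proof (cases "N = 0")
  case False
  define u v where "u = real m powr \<alpha>' * real N powr \<gamma>'" and "v = real m powr (- \<alpha>') * real N powr \<nu>'"
  define \<Lambda> L where "\<Lambda> = (1 + ln (real m)) powr (\<epsilon> / 2)" and "L = (1 + ln (real m)) powr \<epsilon>"
  have mp: "m > 0" using m by (rule N_P_pos)
  have ln0: "ln (real m) \<ge> 0" "ln (real N) \<ge> 0" using mp False by simp_all
  have \<Lambda>: "\<Lambda> \<ge> 1" "L = \<Lambda>\<^sup>2"
    using ln0 par by (auto simp: \<Lambda>_def L_def ge_one_powr_ge_zero powr_add[symmetric] power2_eq_square)
  then have L: "L \<ge> 1" by (simp add: one_le_power)
  have uv: "u \<ge> 0" "v \<ge> 0" by (auto simp: u_def v_def)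
  \<comment> \<open>A sum of squares is at most the square of the sum, as the cross term is
    nonnegative.\<close>
  have goal: "norm (expsum a m N) \<le> (A' * u + B' * v) * \<Lambda>"
    if "norm (expsum a m N) \<le> sqrt ((A'\<^sup>2 * u\<^sup>2 + B'\<^sup>2 * v\<^sup>2) * L)"
  proof -
    have "A'\<^sup>2 * u\<^sup>2 + B'\<^sup>2 * v\<^sup>2 \<le> (A' * u + B' * v)\<^sup>2"
      using uv A' B' by (simp add: power2_sum power_mult_distrib)
    then have "(A'\<^sup>2 * u\<^sup>2 + B'\<^sup>2 * v\<^sup>2) * L \<le> ((A' * u + B' * v) * \<Lambda>)\<^sup>2"
      unfolding \<Lambda>(2) power_mult_distrib by (intro mult_right_mono) auto
    then have "sqrt ((A'\<^sup>2 * u\<^sup>2 + B'\<^sup>2 * v\<^sup>2) * L) \<le> (A' * u + B' * v) * \<Lambda>"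
      using uv A' B' \<Lambda> by (intro real_le_lsqrt) auto
    then show ?thesis using that by linarith
  qed
  have trivial: "norm (expsum a m N) \<le> sqrt ((A'\<^sup>2 * u\<^sup>2 + B'\<^sup>2 * v\<^sup>2) * L)"
    if N: "(real N)\<^sup>2 \<le> u\<^sup>2 \<or> (real N)\<^sup>2 \<le> v\<^sup>2"
  proof -
    have "u\<^sup>2 \<le> A'\<^sup>2 * u\<^sup>2" "v\<^sup>2 \<le> B'\<^sup>2 * v\<^sup>2"
      using A'(1) B'(1) by (simp_all add: mult_le_cancel_right1)
    then have "(real N)\<^sup>2 \<le> A'\<^sup>2 * u\<^sup>2 + B'\<^sup>2 * v\<^sup>2"
      using N zero_le_power2[of "A' * u"] zero_le_power2[of "B' * v"]
      unfolding power_mult_distrib by linarith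
    also have "\<dots> \<le> (A'\<^sup>2 * u\<^sup>2 + B'\<^sup>2 * v\<^sup>2) * L"
      using mult_left_mono[of 1 L "A'\<^sup>2 * u\<^sup>2 + B'\<^sup>2 * v\<^sup>2"] L by simp
    finally have "real N \<le> sqrt ((A'\<^sup>2 * u\<^sup>2 + B'\<^sup>2 * v\<^sup>2) * L)" by (rule real_le_rsqrt)
    then show ?thesis using norm_expsum_le_length[of a m N] by linarith
  qed
  define n \<mu> where "n = ln (real N)" and "\<mu> = ln (real m)"
  \<comment> \<open>\<open>\<delta>\<close> is the logarithm of the balancing value
    \<open>y\<close>. In terms of \<open>n\<close> and \<open>\<mu>\<close>, products of powers
    become linear expressions, which are compared after multiplication by
    \<open>1 + \<alpha>\<close>.\<close>
  define \<delta> where "\<delta> = ((1 + \<gamma> - \<nu>) * n + \<alpha> * \<mu>) / (1 + \<alpha>)"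
  define y where "y = exp \<delta>"
  have pN: "real N powr r = exp (r * n)" and pm: "real m powr r = exp (r * \<mu>)"
    and py: "y powr r = exp (r * \<delta>)" for r
    using False mp by (auto simp: powr_def n_def \<mu>_def y_def)
  have n0: "n \<ge> 0" "\<mu> \<ge> 0" using ln0 by (auto simp: n_def \<mu>_def)
  have N_exp: "real N = exp n" and m_exp: "real m = exp \<mu>"
    using False mp by (auto simp: n_def \<mu>_def)
  have u2: "u\<^sup>2 = exp (2 * \<alpha>' * \<mu> + 2 * \<gamma>' * n)" and v2: "v\<^sup>2 = exp (- 2 * \<alpha>' * \<mu> + 2 * \<nu>' * n)"
    by (simp_all add: u_def v_def pN pm exp_add[symmetric] exp_double[symmetric] power_mult_distrib algebra_simps)
  have clear: "(1 + \<alpha>) * (2 * \<alpha>') = \<alpha>" "(1 + \<alpha>) * (2 * \<gamma>') = 1 + \<gamma> + \<alpha> * \<nu>"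
    "(1 + \<alpha>) * (2 * \<nu>') = (1 + \<alpha>) * (1 + \<nu>) + (1 + \<gamma> - \<nu>) * \<alpha>"
    "(1 + \<alpha>) * \<delta> = (1 + \<gamma> - \<nu>) * n + \<alpha> * \<mu>"
    using par(1) by (simp_all add: \<alpha>'_def \<gamma>'_def \<nu>'_def \<delta>_def field_simps)
  have nz: "1 + \<alpha> \<noteq> 0" using par(1) by simp
  have clear_u: "(1 + \<alpha>) * (2 * \<alpha>' * \<mu> + 2 * \<gamma>' * n) = \<alpha> * \<mu> + (1 + \<gamma> + \<alpha> * \<nu>) * n"
  proof -
    have "(1 + \<alpha>) * (2 * \<alpha>' * \<mu> + 2 * \<gamma>' * n)
        = ((1 + \<alpha>) * (2 * \<alpha>')) * \<mu> + ((1 + \<alpha>) * (2 * \<gamma>')) * n"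
      by (simp only: algebra_simps)
    then show ?thesis unfolding clear .
  qed
  have clear_v: "(1 + \<alpha>) * (- 2 * \<alpha>' * \<mu> + 2 * \<nu>' * n)
      = - (\<alpha> * \<mu>) + ((1 + \<alpha>) * (1 + \<nu>) + (1 + \<gamma> - \<nu>) * \<alpha>) * n"
  proof -
    have "(1 + \<alpha>) * (- 2 * \<alpha>' * \<mu> + 2 * \<nu>' * n)
        = - (((1 + \<alpha>) * (2 * \<alpha>')) * \<mu>) + ((1 + \<alpha>) * (2 * \<nu>')) * n"
      by (simp add: algebra_simps)
    then show ?thesis unfolding clear .
  qed
  \<comment> \<open>With this choice \<open>N powr \<nu> * y\<close> equals
    \<open>u\<^sup>2\<close>, so \<open>\<nu> \<ge> 1\<close> yields
    \<open>N * y \<le> u\<^sup>2\<close>. The next two identities say that the other two terms of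
    the differencing bound are exactly \<open>u\<^sup>2\<close> and
    \<open>v\<^sup>2\<close>.\<close>
  have e1: "n + \<delta> \<le> 2 * \<alpha>' * \<mu> + 2 * \<gamma>' * n"
  proof -
    have "(1 + \<alpha>) * (n + \<delta> + (\<nu> - 1) * n) = (1 + \<alpha>) * (n + (\<nu> - 1) * n) + (1 + \<alpha>) * \<delta>"
      by (simp only: algebra_simps)
    also have "\<dots> = (1 + \<alpha>) * (2 * \<alpha>' * \<mu> + 2 * \<gamma>' * n)"
      unfolding clear_u clear(4) by (simp add: algebra_simps)
    finally have "n + \<delta> + (\<nu> - 1) * n = 2 * \<alpha>' * \<mu> + 2 * \<gamma>' * n"
      using nz mult_cancel_left by blast
    moreover have "(\<nu> - 1) * n \<ge> 0" using par n0 by simp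
    ultimately show ?thesis by linarith
  qed
  have e2: "(1 + \<gamma>) * n + \<alpha> * \<mu> - \<alpha> * \<delta> = 2 * \<alpha>' * \<mu> + 2 * \<gamma>' * n"
  proof -
    have "(1 + \<alpha>) * ((1 + \<gamma>) * n + \<alpha> * \<mu> - \<alpha> * \<delta>)
        = (1 + \<alpha>) * ((1 + \<gamma>) * n + \<alpha> * \<mu>) - \<alpha> * ((1 + \<alpha>) * \<delta>)"
      by (simp only: algebra_simps)
    also have "\<dots> = (1 + \<alpha>) * (2 * \<alpha>' * \<mu> + 2 * \<gamma>' * n)"
      unfolding clear_u clear(4) by (simp add: algebra_simps)
    finally show ?thesis using nz mult_cancel_left by blast
  qed
  have e3: "(1 + \<nu>) * n - \<alpha> * \<mu> + \<alpha> * \<delta> = - 2 * \<alpha>' * \<mu> + 2 * \<nu>' * n"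
  proof -
    have "(1 + \<alpha>) * ((1 + \<nu>) * n - \<alpha> * \<mu> + \<alpha> * \<delta>)
        = (1 + \<alpha>) * ((1 + \<nu>) * n - \<alpha> * \<mu>) + \<alpha> * ((1 + \<alpha>) * \<delta>)"
      by (simp only: algebra_simps)
    also have "\<dots> = (1 + \<alpha>) * (- 2 * \<alpha>' * \<mu> + 2 * \<nu>' * n)"
      unfolding clear_v clear(4) by (simp add: algebra_simps)
    finally show ?thesis using nz mult_cancel_left by blast
  qed
  have Ny: "real N * y \<le> u\<^sup>2" using e1 by (simp add: N_exp y_def u2 exp_add[symmetric])
  have y1: "y \<ge> 1" using par n0 by (simp add: y_def \<delta>_def)
  have "norm (expsum a m N) \<le> sqrt ((A'\<^sup>2 * u\<^sup>2 + B'\<^sup>2 * v\<^sup>2) * L)"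
  proof (cases "y < real m")
    case False
    then have "\<mu> \<le> \<delta>" by (simp add: y_def m_exp)
    \<comment> \<open>No divisor of \<open>m\<close> lies close to \<open>y\<close> here, but
      \<open>y \<ge> m\<close> makes \<open>v\<close> at least \<open>N\<close>.\<close>
    have "- 2 * \<alpha>' * \<mu> + 2 * \<nu>' * n - 2 * n = (\<nu> - 1) * n + \<alpha> * (\<delta> - \<mu>)"
      using e3 by (simp add: algebra_simps)
    moreover have "(\<nu> - 1) * n + \<alpha> * (\<delta> - \<mu>) \<ge> 0" using par n0 \<open>\<mu> \<le> \<delta>\<close> by simp
    ultimately have "2 * n \<le> - 2 * \<alpha>' * \<mu> + 2 * \<nu>' * n" by linarith
    then have "(real N)\<^sup>2 \<le> v\<^sup>2" by (simp add: N_exp v2 exp_double[symmetric])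
    then show ?thesis using trivial by blast
  next
    case True
    obtain d where d: "d dvd m" "real d \<le> y" "y < real (Q_P P) * real d"
      using exists_divisor_near[OF m y1 True] by blast
    show ?thesis
    proof (cases "ord d b \<le> N")
      case False
      have dP: "d \<in> N_P P" using N_P_dvd[OF m d(1)] .
      \<comment> \<open>No shift fits into the range, but then
        \<open>N < ord d b \<le> d \<le> y\<close>, so
        \<open>N\<^sup>2 \<le> N * y \<le> u\<^sup>2\<close>.\<close>
      have "ord d b \<le> d"
        using dvd_imp_le[OF order_divides_totient[OF coprime_N_P[OF dP]]] N_P_pos[OF dP] totient_le[of d] by simp
      then have "real N \<le> y" using False d(2) by linarith
      then have "(real N)\<^sup>2 \<le> real N * y" by (simp add: power2_eq_square mult_left_mono)
      then show ?thesis using Ny trivial by linarith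
    next
      case True
      \<comment> \<open>The moduli of the correlations divide \<open>m\<close>, so their logarithmic
        factors are replaced by the common \<open>L\<close>.\<close>
      have "norm (expsum a' m' N') \<le> (A * real m' powr \<alpha> * real N' powr \<gamma> + B * real m' powr (- \<alpha>) * real N' powr \<nu>) * L"
        if "m' dvd m" "coprime a' (int m')" for m' a' N'
      proof -
        have m'P: "m' \<in> N_P P" using N_P_dvd[OF m that(1)] .
        have "real m' \<le> real m" using that(1) mp by (simp add: dvd_imp_le)
        then have "(1 + ln (real m')) powr \<epsilon> \<le> L"
          unfolding L_def using N_P_pos[OF m'P] par by (intro powr_mono2) auto
        then have "(A * real m' powr \<alpha> * real N' powr \<gamma> + B * real m' powr (- \<alpha>) * real N' powr \<nu>) * (1 + ln (real m')) powr \<epsilon>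
          \<le> (A * real m' powr \<alpha> * real N' powr \<gamma> + B * real m' powr (- \<alpha>) * real N' powr \<nu>) * L"
          using par by (intro mult_left_mono) auto
        then show ?thesis using IH[OF m'P that(2), of N'] by linarith
      qed
      then have "(norm (expsum a m N))\<^sup>2 \<le> 4 * real N * y
        + 2 * A * real (Q_P P) powr \<alpha> * (real N powr (1 + \<gamma>) * real m powr \<alpha> * y powr (- \<alpha>)) * L
        + 2 * B * M_P b P * C_P P (1 - \<alpha>) * (real N powr (1 + \<nu>) * real m powr (- \<alpha>) * y powr \<alpha>) * L"
        using par L by (intro norm_expsum_differencing[OF m a d True]) auto
      also have "real N powr (1 + \<gamma>) * real m powr \<alpha> * y powr (- \<alpha>) = u\<^sup>2"
        using e2 by (simp add: pN pm py u2 exp_add[symmetric])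
      also have "real N powr (1 + \<nu>) * real m powr (- \<alpha>) * y powr \<alpha> = v\<^sup>2"
        using e3 by (simp add: pN pm py v2 exp_add[symmetric])
      also have "4 * real N * y + 2 * A * real (Q_P P) powr \<alpha> * u\<^sup>2 * L
          + 2 * B * M_P b P * C_P P (1 - \<alpha>) * v\<^sup>2 * L
        \<le> (4 + 2 * A * real (Q_P P) powr \<alpha>) * u\<^sup>2 * L + (2 * B * M_P b P * C_P P (1 - \<alpha>)) * v\<^sup>2 * L"
      proof -
        have "real N * y \<le> u\<^sup>2 * L" using Ny L mult_left_mono[of 1 L "u\<^sup>2"] by simp
        then show ?thesis by (simp add: algebra_simps)
      qed
      also have "\<dots> \<le> A'\<^sup>2 * u\<^sup>2 * L + B'\<^sup>2 * v\<^sup>2 * L"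
        using A' B' L by (intro add_mono mult_right_mono) auto
      finally show ?thesis by (intro real_le_rsqrt) (simp add: algebra_simps)
    qed
  qed
  from goal[OF this] show ?thesis by (simp add: u_def v_def \<Lambda>_def mult.assoc)
qed (simp add: expsum_def)

text \<open>The prescribed constants dominate those of the differencing bound: since
  \<open>2 ^ (card P + 2) \<ge> 4\<close> and the Euler products are at least 1, the first summand
  under the root of \<open>coeff_A\<close> supplies \<open>4 + 4 * A * Q\<close>. For
  \<open>coeff_B\<close>, the factor \<open>2 powr (1 + alpha k)\<close> is at least 2.\<close>

lemma coeff_bounds: "coeff_A b P k \<ge> 1 \<and> coeff_B b P k \<ge> 1"
  and coeff_A_Suc: "(coeff_A b P (Suc k))\<^sup>2 \<ge> 4 + 2 * coeff_A b P k * real (Q_P P) powr alpha k"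
  and coeff_B_Suc: "(coeff_B b P (Suc k))\<^sup>2 \<ge> 2 * coeff_B b P k * M_P b P * C_P P (1 - alpha k)"
proof -
  have M: "real (M_P b P) \<ge> 1" and Q: "real (Q_P P) \<ge> 1" using M_pos Q_pos by simp_all
  have step: "coeff_A b P (Suc k) \<ge> 1 \<and> coeff_B b P (Suc k) \<ge> 1
      \<and> (coeff_A b P (Suc k))\<^sup>2 \<ge> 4 + 2 * coeff_A b P k * real (Q_P P) powr alpha k
      \<and> (coeff_B b P (Suc k))\<^sup>2 \<ge> 2 * coeff_B b P k * M_P b P * C_P P (1 - alpha k)"
    if A: "coeff_A b P k \<ge> 1" and B: "coeff_B b P k \<ge> 1" for k
  proof -
    note a = alpha_pos[of k] alpha_le_half[of k]
    have C: "C_P P (alpha k) \<ge> 1" "C_P P (1 + alpha k) \<ge> 1" "C_P P (1 - alpha k) \<ge> 1"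
      using a prm by (auto intro!: C_P_ge_1)
    define X where "X = 2 ^ (card P + 2) * real (Q_P P) * (coeff_A b P k + coeff_B b P k) * C_P P (alpha k)
          + 2 * real (Q_P P) + 2 * coeff_A b P k * real (M_P b P) * C_P P (1 + alpha k)"
    define Y where "Y = 2 powr (1 + alpha k) * coeff_B b P k * real (M_P b P) * real (Q_P P) powr alpha k
          * C_P P (1 - alpha k)"
    have "4 + 4 * coeff_A b P k * real (Q_P P) \<le> 4 * real (Q_P P) * (coeff_A b P k + coeff_B b P k)"
      using mult_mono[OF Q B] Q by (simp add: algebra_simps)
    also have "\<dots> = 4 * real (Q_P P) * (coeff_A b P k + coeff_B b P k) * 1" by simp
    also have "\<dots> \<le> 2 ^ (card P + 2) * real (Q_P P) * (coeff_A b P k + coeff_B b P k) * C_P P (alpha k)"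
      using A B C by (intro mult_mono) auto
    also have "\<dots> \<le> X" using A C M Q by (simp add: X_def)
    finally have "4 + 4 * coeff_A b P k * real (Q_P P) \<le> X" .
    moreover have "real (Q_P P) powr alpha k \<le> real (Q_P P) powr 1" using Q a by (intro powr_mono) auto
    then have "coeff_A b P k * real (Q_P P) powr alpha k \<le> coeff_A b P k * real (Q_P P)"
      using A Q by (intro mult_left_mono) auto
    moreover have "0 \<le> coeff_A b P k * real (Q_P P) powr alpha k" using A by simp
    ultimately have X: "4 + 2 * coeff_A b P k * real (Q_P P) powr alpha k \<le> X" "X \<ge> 1" by linarith+
    have "2 * coeff_B b P k * M_P b P * C_P P (1 - alpha k)
        = 2 powr 1 * coeff_B b P k * M_P b P * 1 * C_P P (1 - alpha k)" by simp
    also have "\<dots> \<le> Y"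
      unfolding Y_def using B C Q a by (intro mult_mono powr_mono) (auto intro: ge_one_powr_ge_zero)
    finally have Y: "2 * coeff_B b P k * M_P b P * C_P P (1 - alpha k) \<le> Y" .
    have "1 * 1 * 1 \<le> coeff_B b P k * M_P b P * C_P P (1 - alpha k)"
      using B M C by (intro mult_mono) auto
    then have "Y \<ge> 1" using Y by simp
    moreover have "coeff_A b P (Suc k) = sqrt X" "coeff_B b P (Suc k) = sqrt Y"
      by (simp_all add: X_def Y_def)
    ultimately show ?thesis using X Y by simp
  qed
  have ge1: "coeff_A b P k \<ge> 1 \<and> coeff_B b P k \<ge> 1" for k
    by (induction k) (use M step in auto)
  then show "coeff_A b P k \<ge> 1 \<and> coeff_B b P k \<ge> 1" .
  show "(coeff_A b P (Suc k))\<^sup>2 \<ge> 4 + 2 * coeff_A b P k * real (Q_P P) powr alpha k"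
    and "(coeff_B b P (Suc k))\<^sup>2 \<ge> 2 * coeff_B b P k * M_P b P * C_P P (1 - alpha k)"
    using step ge1 by blast+
qed

lemma norm_expsum_le:
  assumes "m \<in> N_P P" "coprime a (int m)"
  shows "norm (expsum a m N)
    \<le> (coeff_A b P k * real m powr alpha k * real N powr gamma k
        + coeff_B b P k * real m powr (- alpha k) * real N powr nu k)
      * (1 + ln (real m)) powr (1 / 2 ^ k)"
  using assms
proof (induction k arbitrary: m a N)
  case 0
  have "m > 0" using 0 N_P_pos by blast
  \<comment> \<open>\<open>N = 0\<close> is separate because \<open>0 powr 0\<close> is 0, so the
    factor \<open>real N powr gamma 0\<close> disappears only for positive \<open>N\<close>.\<close>
  show ?case
  proof (cases "N = 0")
    case False
    have "1 + ln (real m) > 0" using \<open>m > 0\<close> by (simp add: add_pos_nonneg)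
    moreover have a0: "alpha 0 = 1 / 2" by (simp add: alpha_def)
    ultimately show ?thesis using norm_expsum_base[OF 0, of N] False by (simp add: a0)
  qed (simp add: expsum_def)
next
  case (Suc k)
  have "alpha k < 1" using alpha_le_half[of k] by simp
  have "norm (expsum a m N) \<le> (coeff_A b P (Suc k) * real m powr (alpha k / (2 * (1 + alpha k)))
        * real N powr ((1 + gamma k + alpha k * nu k) / (2 * (1 + alpha k)))
      + coeff_B b P (Suc k) * real m powr (- (alpha k / (2 * (1 + alpha k))))
        * real N powr ((1 + nu k) / 2 + (1 + gamma k - nu k) * alpha k / (2 * (1 + alpha k))))
    * (1 + ln (real m)) powr ((1 / 2 ^ k) / 2)"
  proof (rule norm_expsum_step[OF Suc.prems alpha_pos \<open>alpha k < 1\<close>])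
    show "0 \<le> coeff_A b P k" "0 \<le> coeff_B b P k"
      using coeff_bounds[of k] by simp_all
    show "1 \<le> coeff_A b P (Suc k)" "1 \<le> coeff_B b P (Suc k)"
      using coeff_bounds[of "Suc k"] by blast+
  qed (use gamma_nu_bounds[of k] coeff_A_Suc coeff_B_Suc Suc.IH in auto)
  then show ?case
    unfolding alpha_Suc gamma.simps nu.simps by (simp add: mult.commute)
qed

end

theorem theorem5p1:
  fixes b m k N :: nat and a :: int and P :: "nat set"
  assumes "b \<ge> 2"
    and "finite P"
    and "\<forall>p\<in>P. prime p \<and> coprime p b"
    and "m \<in> N_P P"
    and "gcd a (int m) = 1"
  shows "norm (\<Sum>n=1..N. e_2pi (of_int a / of_nat m * of_nat b ^ n))
    \<le> (coeff_A b P k * real m powr alpha k * real N powr gamma k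
        + coeff_B b P k * real m powr (- alpha k) * real N powr nu k)
      * (1 + ln (real m)) powr (1 / 2 ^ k)"
proof -
  interpret prime_base b P by unfold_locales (use assms in auto)
  have "(\<Sum>n=1..N. e_2pi (of_int a / of_nat m * of_nat b ^ n)) = expsum a m N"
    by (simp add: expsum_def addchar_def)
  moreover have "coprime a (int m)" using assms(5) by (simp add: coprime_iff_gcd_eq_1)
  ultimately show ?thesis using norm_expsum_le[OF assms(4)] by simp
qed

end
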